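(* Let $\mathsf{AP}$ be a finite set of atomic propositions and let $\varphi,\psi$ be $\mathsf{LTL}[\mathsf{AP}]$-formulas. If the set $[\![\varphi]\!]\setminus[\![\psi]\!]$ is non-empty, then it contains a finitely presentable word.
   Context: Words: for a countable ordinal $\alpha$, an $\alpha$-word is a function $w:\alpha\to\mathcal{P}(\mathsf{AP})$; $|w|=\alpha$; for $\beta<|w|$, $w[\beta..]$ is the suffix $w'$ with $w'[\gamma]=w[\beta+\gamma]$ (of length the unique $\gamma_0$ with $\beta+\gamma_0=|w|$). LTL syntax: $\varphi::=\top\mid p\mid\neg\varphi\mid\varphi\land\varphi\mid\mathsf{X}\varphi\mid\mathsf{F}\varphi\mid\varphi\,\mathsf{U}\,\varphi$ with $p\in\mathsf{AP}$. Semantics over ordinal words: $w\models\top$ always; $w\models p$ iff $p\in w[0]$; $\neg,\land$ as usual; $w\models\mathsf{X}\varphi$ iff $|w|>1$ and $w[1..]\models\varphi$; $w\models\mathsf{F}\varphi$ iff there is $\alpha<|w|$ with $w[\alpha..]\models\varphi$; $w\models\varphi\,\mathsf{U}\,\psi$ iff there is $\gamma<|w|$ with $w[\gamma..]\models\psi$ and $w[\beta..]\models\varphi$ for all $\beta<\gamma$. $[\![\varphi]\!]$ is the set of all words of countable ordinal length satisfying $\varphi$. Finitely presentable words: word-expressions are generated by: each $\sigma\subseteq\mathsf{AP}$ (denoting the one-letter word $\sigma$); $A\cdot B$ (if $A$ denotes an $\alpha$-word $w_A$ and $B$ a $\beta$-word $w_B$, it denotes the $(\alpha+\beta)$-word equal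 to $w_A[\gamma]$ for $\gamma<\alpha$ and $w_B[\gamma-\alpha]$ otherwise); $(A)^\omega$ (denoting the $(\alpha\cdot\omega)$-word $\gamma\mapsto w_A[\gamma\bmod\alpha]$). A word is finitely presentable if some word-expression denotes it. *)

theory Defs
  imports "HOL-Library.FuncSet" "HOL-Library.Countable_Set"
begin

section \<open>Countable ordinals\<close>

text \<open>
  The well-order \<^term>\<open>card_suc natLeq\<close> is the initial ordinal of cardinality the successor of
  \<open>\<aleph>\<^sub>0\<close>. Its elements serve as the countable ordinals, so that an ordinal \<open>\<alpha>\<close> is identified
  with the set \<open>{..<\<alpha>}\<close> of the smaller ones.
\<close>

typedef cord = "UNIV :: nat suc set" ..

instantiation cord :: wellorder
begin

definition less_eq_cord :: "cord \<Rightarrow> cord \<Rightarrow> bool" where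
  "\<alpha> \<le> \<beta> \<longleftrightarrow> (Rep_cord \<alpha>, Rep_cord \<beta>) \<in> card_suc natLeq"

definition less_cord :: "cord \<Rightarrow> cord \<Rightarrow> bool" where
  "\<alpha> < \<beta> \<longleftrightarrow> \<alpha> \<le> \<beta> \<and> \<not> \<beta> \<le> (\<alpha>::cord)"

instance
proof
  have wo: "Well_order (card_suc natLeq)" and F: "Field (card_suc natLeq) = UNIV"
    using Card_order_card_suc[OF natLeq_card_order] Field_card_suc
    by (auto simp: card_order_on_def)
  interpret wo_rel "card_suc natLeq" by (simp add: wo wo_rel_def)
  fix x y z :: cord
  show "(x < y) = (x \<le> y \<and> \<not> y \<le> x)" by (rule less_cord_def)
  show "x \<le> x" using REFL F by (auto simp: less_eq_cord_def refl_on_def)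
  show "x \<le> y \<Longrightarrow> y \<le> z \<Longrightarrow> x \<le> z"
    using TRANS by (auto simp: less_eq_cord_def trans_def)
  show "x \<le> y \<Longrightarrow> y \<le> x \<Longrightarrow> x = y"
    using ANTISYM Rep_cord_inject by (auto simp: less_eq_cord_def antisym_def)
  show "x \<le> y \<or> y \<le> x" using TOTALS F by (auto simp: less_eq_cord_def)
  fix P :: "cord \<Rightarrow> bool" and a
  assume step: "\<And>x. (\<And>y. y < x \<Longrightarrow> P y) \<Longrightarrow> P x"
  have "P (Abs_cord u)" for u
  proof (induction u rule: wf_induct_rule[OF WF])
    case (1 u)
    show ?case
    proof (rule step)
      fix y assume "y < Abs_cord u"
      then have "(Rep_cord y, u) \<in> card_suc natLeq - Id"
        by (auto simp: less_cord_def less_eq_cord_def Abs_cord_inverse)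
      from 1[OF this] show "P y" by (simp add: Rep_cord_inverse)
    qed
  qed
  then show "P a" by (metis Rep_cord_inverse)
qed

end

context includes cardinal_syntax
begin

lemma ordIso_cord: "card_suc natLeq =o {(\<beta>::cord, \<gamma>). \<beta> \<le> \<gamma>}"
proof -
  have "{(\<beta>::cord, \<gamma>). \<beta> \<le> \<gamma>} = dir_image (card_suc natLeq) Abs_cord"
    unfolding dir_image_def less_eq_cord_def
    by (auto simp: Abs_cord_inverse) (metis Rep_cord_inverse)
  moreover have "Well_order (card_suc natLeq)"
    using Card_order_card_suc[OF natLeq_card_order] by (auto simp: card_order_on_def)
  ultimately show ?thesis
    by (metis dir_image_ordIso inj_on_def Abs_cord_inject UNIV_I)
qed

lemma Card_order_cord: "Card_order {(\<beta>::cord, \<gamma>). \<beta> \<le> \<gamma>}"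
  using Card_order_ordIso2[OF Card_order_card_suc[OF natLeq_card_order] ordIso_cord] .

lemma Field_cord: "Field {(\<beta>::cord, \<gamma>). \<beta> \<le> \<gamma>} = UNIV"
  by (auto simp: Field_def)

lemma countable_iff_ordLeq: "countable A \<longleftrightarrow> |A| \<le>o natLeq"
proof -
  have "countable A \<longleftrightarrow> |A| \<le>o |UNIV::nat set|"
    by (simp add: countable_def card_of_ordLeq[symmetric])
  then show ?thesis
    using card_of_nat ordIso_symmetric ordLeq_ordIso_trans by blast
qed

lemma underS_cord: "underS {(\<beta>::cord, \<gamma>). \<beta> \<le> \<gamma>} \<alpha> = {..<\<alpha>}"
  by (auto simp: underS_def)

lemma countable_lessThan_cord: "countable {..<\<alpha>::cord}"
proof -
  have "|{..<\<alpha>}| <o {(\<beta>::cord, \<gamma>). \<beta> \<le> \<gamma>}"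
    using card_of_underS[OF Card_order_cord, of \<alpha>] by (simp add: Field_cord underS_cord)
  moreover have "{(\<beta>::cord, \<gamma>). \<beta> \<le> \<gamma>} =o cardSuc natLeq"
    using cardSuc_ordIso_card_suc[OF natLeq_card_order] ordIso_cord ordIso_symmetric
      ordIso_transitive by blast
  ultimately have "|{..<\<alpha>}| <o cardSuc natLeq" by (rule ordLess_ordIso_trans)
  then show ?thesis
    using cardSuc_ordLeq_ordLess[OF natLeq_Card_order card_of_Card_order] countable_iff_ordLeq
    by blast
qed

lemma uncountable_cord: "uncountable (UNIV :: cord set)"
proof
  assume "countable (UNIV :: cord set)"
  then have "|UNIV :: cord set| \<le>o natLeq" by (simp add: countable_iff_ordLeq)
  moreover have "|UNIV :: cord set| =o card_suc natLeq"
    using card_of_Field_ordIso[OF Card_order_cord] ordIso_cord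
    by (metis Field_cord ordIso_symmetric ordIso_transitive)
  ultimately show False
    using card_suc_greater[OF natLeq_card_order]
    by (meson not_ordLess_ordLeq ordIso_ordLeq_trans ordIso_symmetric)
qed

lemma countable_cord_bounded:
  assumes "countable (A :: cord set)"
  shows "\<exists>\<gamma>. \<forall>\<alpha>\<in>A. \<alpha> < \<gamma>"
proof -
  have "countable (\<Union>\<alpha>\<in>A. insert \<alpha> {..<\<alpha>})"
    using assms countable_lessThan_cord by auto
  then obtain \<gamma> where "\<gamma> \<notin> (\<Union>\<alpha>\<in>A. insert \<alpha> {..<\<alpha>})"
    using uncountable_cord by (metis UNIV_eq_I)
  then show ?thesis by (auto intro!: exI[of _ \<gamma>])
qed

lemma countable_Well_order_ordIso_cord:
  assumes "Well_order r" "countable (Field r)"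
  shows "\<exists>\<alpha>::cord. r =o {(\<beta>, \<gamma>). \<beta> \<le> \<gamma> \<and> \<gamma> < \<alpha>}"
proof -
  let ?c = "{(\<beta>::cord, \<gamma>). \<beta> \<le> \<gamma>}"
  have wo: "Well_order ?c" using Card_order_cord by (simp add: card_order_on_def)
  have "\<not> ?c \<le>o r"
  proof
    assume "?c \<le>o r"
    then have "|UNIV :: cord set| \<le>o |Field r|" using card_of_mono2 Field_cord by metis
    moreover have "|Field r| \<le>o natLeq" using assms(2) by (simp add: countable_iff_ordLeq)
    ultimately have "|UNIV :: cord set| \<le>o natLeq" by (rule ordLeq_transitive)
    then show False using uncountable_cord by (simp add: countable_iff_ordLeq)
  qed
  then have "r <o ?c" using assms(1) wo not_ordLeq_iff_ordLess by blast
  then obtain \<alpha> where "r =o Restr ?c (underS ?c \<alpha>)"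
    using ordLess_iff_ordIso_Restr[OF wo assms(1)] by blast
  moreover have "Restr ?c (underS ?c \<alpha>) = {(\<beta>, \<gamma>). \<beta> \<le> \<gamma> \<and> \<gamma> < \<alpha>}"
    by (auto simp: underS_cord)
  ultimately show ?thesis by auto
qed

end


subsection \<open>Ordinal arithmetic\<close>

instantiation cord :: "{zero, one, plus, minus, times}"
begin

definition zero_cord :: cord where
  "0 = (LEAST \<alpha>::cord. True)"

definition one_cord :: cord where
  "1 = (LEAST \<alpha>::cord. 0 < \<alpha>)"

text \<open>\<open>\<alpha> + \<beta> = sup ({\<alpha>} \<union> {(\<alpha> + \<delta>) + 1 | \<delta> < \<beta>})\<close>\<close>

function plus_cord :: "cord \<Rightarrow> cord \<Rightarrow> cord" where
  "plus_cord \<alpha> \<beta> = (LEAST \<gamma>. \<alpha> \<le> \<gamma> \<and> (\<forall>\<delta>\<in>{..<\<beta>}. plus_cord \<alpha> \<delta> < \<gamma>))"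
  by pat_completeness auto
termination by (relation "inv_image {(x, y). x < y} snd") (auto simp: wf)

declare plus_cord.simps [simp del]

text \<open>\<open>\<alpha> - \<beta>\<close> is only meaningful for \<open>\<beta> \<le> \<alpha>\<close>.\<close>

definition minus_cord :: "cord \<Rightarrow> cord \<Rightarrow> cord" where
  "\<alpha> - \<beta> = (THE \<gamma>::cord. \<beta> + \<gamma> = \<alpha>)"

text \<open>\<open>\<alpha> * \<beta> = sup {\<alpha> * \<delta> + \<alpha> | \<delta> < \<beta>}\<close>\<close>

function times_cord :: "cord \<Rightarrow> cord \<Rightarrow> cord" where
  "times_cord \<alpha> \<beta> = (LEAST \<gamma>. \<forall>\<delta>\<in>{..<\<beta>}. times_cord \<alpha> \<delta> + \<alpha> \<le> \<gamma>)"
  by pat_completeness auto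
termination by (relation "inv_image {(x, y). x < y} snd") (auto simp: wf)

declare times_cord.simps [simp del]

instance ..

end

definition omega :: cord where
  "omega = (LEAST \<gamma>. 0 < \<gamma> \<and> (\<forall>\<delta><\<gamma>. \<delta> + 1 < \<gamma>))"

definition cord_mod :: "cord \<Rightarrow> cord \<Rightarrow> cord" where
  "cord_mod \<gamma> \<alpha> = (THE \<rho>. \<rho> < \<alpha> \<and> (\<exists>\<kappa>. \<gamma> = \<alpha> * \<kappa> + \<rho>))"

text \<open>The minima, differences and remainders above exist.\<close>

lemma zero_le_cord [simp]: "0 \<le> (\<alpha>::cord)"
  unfolding zero_cord_def by (rule Least_le) simp

lemma not_less_zero_cord [simp]: "\<not> (\<alpha>::cord) < 0"
  by (simp add: not_less)

lemma plus_cord_props: "\<alpha> \<le> \<alpha> + \<beta> \<and> (\<forall>\<delta><\<beta>. \<alpha> + \<delta> < \<alpha> + (\<beta>::cord))"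
proof -
  obtain \<gamma> where \<gamma>: "\<forall>x \<in> insert \<alpha> ((\<lambda>\<delta>. \<alpha> + \<delta>) ` {..<\<beta>}). x < \<gamma>"
    using countable_cord_bounded[of "insert \<alpha> ((\<lambda>\<delta>. \<alpha> + \<delta>) ` {..<\<beta>})"] countable_lessThan_cord
    by blast
  have "\<exists>\<gamma>. \<alpha> \<le> \<gamma> \<and> (\<forall>\<delta>\<in>{..<\<beta>}. \<alpha> + \<delta> < \<gamma>)"
    using \<gamma> by (intro exI[of _ \<gamma>]) auto
  from LeastI_ex[OF this] show ?thesis unfolding plus_cord.simps[of \<alpha> \<beta>] by auto
qed

lemma le_plus_cord [simp]: "\<alpha> \<le> \<alpha> + (\<beta>::cord)"
  using plus_cord_props by blast

lemma plus_cord_less_iff [simp]: "\<alpha> + \<beta> < \<alpha> + \<gamma> \<longleftrightarrow> \<beta> < (\<gamma>::cord)"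
  by (metis less_asym' linorder_neq_iff plus_cord_props)

lemma plus_cord_left_cancel [simp]: "\<alpha> + \<beta> = \<alpha> + \<gamma> \<longleftrightarrow> \<beta> = (\<gamma>::cord)"
  by (metis linorder_neq_iff plus_cord_less_iff)

lemma plus_cord_least:
  "\<alpha> \<le> \<gamma> \<Longrightarrow> (\<And>\<delta>. \<delta> < \<beta> \<Longrightarrow> \<alpha> + \<delta> < \<gamma>) \<Longrightarrow> \<alpha> + \<beta> \<le> (\<gamma>::cord)"
  unfolding plus_cord.simps[of \<alpha> \<beta>] by (rule Least_le) auto

lemma plus_zero_cord [simp]: "\<alpha> + 0 = (\<alpha>::cord)"
  by (rule antisym) (auto intro: plus_cord_least)

lemma le_plus_cord_right: "\<beta> \<le> \<alpha> + (\<beta>::cord)"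
proof (induction \<beta> rule: less_induct)
  case (less \<beta>)
  show ?case
  proof (rule ccontr)
    assume "\<not> \<beta> \<le> \<alpha> + \<beta>"
    then have "\<alpha> + \<beta> < \<beta>" by simp
    with less.IH[OF this] show False by (metis plus_cord_less_iff not_less)
  qed
qed

lemma cord_difference_ex1:
  assumes "\<beta> \<le> (\<alpha>::cord)"
  shows "\<exists>!\<gamma>. \<beta> + \<gamma> = \<alpha>"
proof -
  define \<gamma> where "\<gamma> = (LEAST \<gamma>. \<alpha> \<le> \<beta> + \<gamma>)"
  have ge: "\<alpha> \<le> \<beta> + \<gamma>" unfolding \<gamma>_def by (rule LeastI, rule le_plus_cord_right)
  have "\<beta> + \<delta> < \<alpha>" if "\<delta> < \<gamma>" for \<delta>
    using not_less_Least[OF that[unfolded \<gamma>_def]] by simp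
  with ge have "\<beta> + \<gamma> = \<alpha>" by (intro antisym plus_cord_least assms)
  then show ?thesis by auto
qed

lemma cord_plus_minus: "\<beta> \<le> \<alpha> \<Longrightarrow> \<beta> + (\<alpha> - \<beta>) = (\<alpha>::cord)"
  unfolding minus_cord_def by (rule theI'[OF cord_difference_ex1])

lemma one_cord_le_iff: "1 \<le> \<alpha> \<longleftrightarrow> 0 < (\<alpha>::cord)"
proof -
  obtain \<gamma> where "(0::cord) < \<gamma>" using countable_cord_bounded[of "{0}"] by auto
  then have "0 < (1::cord)" unfolding one_cord_def by (rule LeastI)
  moreover have "1 \<le> \<alpha>" if "0 < \<alpha>"
    unfolding one_cord_def using that by (rule Least_le)
  ultimately show ?thesis by auto
qed

lemma less_one_cord_iff: "\<alpha> < 1 \<longleftrightarrow> \<alpha> = (0::cord)"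
  by (metis one_cord_le_iff not_less zero_le_cord order.antisym order.refl)

lemma less_plus_one_cord: "\<alpha> < \<beta> + 1 \<longleftrightarrow> \<alpha> \<le> (\<beta>::cord)"
proof
  assume "\<alpha> \<le> \<beta>"
  then show "\<alpha> < \<beta> + 1"
    by (metis less_one_cord_iff plus_cord_less_iff plus_zero_cord le_less_trans)
next
  assume *: "\<alpha> < \<beta> + 1"
  show "\<alpha> \<le> \<beta>"
  proof (rule ccontr)
    assume "\<not> \<alpha> \<le> \<beta>"
    then have "\<beta> + 1 \<le> \<alpha>" by (intro plus_cord_least) (auto simp: less_one_cord_iff)
    with * show False by simp
  qed
qed

lemma omega_limit: "0 < omega \<and> (\<forall>\<delta><omega. \<delta> + 1 < omega)"
proof -
  define A where "A = range (\<lambda>n. ((\<lambda>\<alpha>::cord. \<alpha> + 1) ^^ n) 0)"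
  define \<gamma> where "\<gamma> = (LEAST \<gamma>. \<forall>\<alpha>\<in>A. \<alpha> < \<gamma>)"
  have "countable A" by (simp add: A_def)
  then have up: "\<forall>\<alpha>\<in>A. \<alpha> < \<gamma>"
    unfolding \<gamma>_def by (rule LeastI_ex[OF countable_cord_bounded])
  have "0 \<in> A" unfolding A_def by (rule image_eqI[of _ _ 0]) auto
  moreover have "\<delta> + 1 < \<gamma>" if "\<delta> < \<gamma>" for \<delta>
  proof -
    have "\<not> (\<forall>\<alpha>\<in>A. \<alpha> < \<delta>)" using not_less_Least[OF that[unfolded \<gamma>_def]] .
    then obtain n where "\<delta> \<le> ((\<lambda>\<alpha>::cord. \<alpha> + 1) ^^ n) 0" by (auto simp: A_def not_less)
    then have "\<delta> < ((\<lambda>\<alpha>::cord. \<alpha> + 1) ^^ Suc n) 0" by (simp add: less_plus_one_cord)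
    then have "\<delta> + 1 \<le> ((\<lambda>\<alpha>::cord. \<alpha> + 1) ^^ Suc n) 0"
      by (intro plus_cord_least) (auto simp: less_one_cord_iff)
    also have "\<dots> < \<gamma>" using up unfolding A_def by blast
    finally show ?thesis .
  qed
  ultimately have "0 < \<gamma> \<and> (\<forall>\<delta><\<gamma>. \<delta> + 1 < \<gamma>)" using up by auto
  then show ?thesis unfolding omega_def by (rule LeastI)
qed

lemma times_cord_props: "\<delta> < \<beta> \<Longrightarrow> \<alpha> * \<delta> + \<alpha> \<le> \<alpha> * (\<beta>::cord)"
proof -
  obtain \<gamma> where \<gamma>: "\<forall>x \<in> ((\<lambda>\<delta>. \<alpha> * \<delta> + \<alpha>) ` {..<\<beta>}). x < \<gamma>"
    using countable_cord_bounded[of "(\<lambda>\<delta>. \<alpha> * \<delta> + \<alpha>) ` {..<\<beta>}"] countable_lessThan_cord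
    by blast
  have "\<exists>\<gamma>. \<forall>\<delta>\<in>{..<\<beta>}. \<alpha> * \<delta> + \<alpha> \<le> \<gamma>"
    using \<gamma> by (intro exI[of _ \<gamma>]) (auto intro: less_imp_le)
  from LeastI_ex[OF this] show "\<delta> < \<beta> \<Longrightarrow> \<alpha> * \<delta> + \<alpha> \<le> \<alpha> * \<beta>"
    unfolding times_cord.simps[of \<alpha> \<beta>] by auto
qed

lemma times_cord_least:
  "(\<And>\<delta>. \<delta> < \<beta> \<Longrightarrow> \<alpha> * \<delta> + \<alpha> \<le> \<gamma>) \<Longrightarrow> \<alpha> * \<beta> \<le> (\<gamma>::cord)"
  unfolding times_cord.simps[of \<alpha> \<beta>] by (rule Least_le) auto

lemma times_zero_cord [simp]: "\<alpha> * 0 = (0::cord)"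
  by (rule antisym) (auto intro: times_cord_least)

lemma times_cord_strict_mono:
  assumes "0 < \<alpha>" "\<delta> < \<beta>"
  shows "\<alpha> * \<delta> < \<alpha> * (\<beta>::cord)"
proof -
  have "\<alpha> * \<delta> + 0 < \<alpha> * \<delta> + \<alpha>" using assms(1) plus_cord_less_iff by blast
  then show ?thesis using times_cord_props[OF assms(2), of \<alpha>] by simp
qed

lemma times_omega_pos: "0 < \<alpha> \<Longrightarrow> 0 < \<alpha> * omega"
  using times_cord_strict_mono[of \<alpha> 0 omega] omega_limit by simp

lemma cord_mod_ex1:
  assumes "0 < (\<alpha>::cord)"
  shows "\<exists>!\<rho>. \<rho> < \<alpha> \<and> (\<exists>\<kappa>. \<gamma> = \<alpha> * \<kappa> + \<rho>)"
proof (rule ex_ex1I)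
  have "\<beta> \<le> \<alpha> * \<beta>" for \<beta>
  proof (induction \<beta> rule: less_induct)
    case (less \<beta>)
    show ?case
    proof (rule ccontr)
      assume "\<not> \<beta> \<le> \<alpha> * \<beta>"
      then have "\<alpha> * \<beta> < \<beta>" by simp
      with less.IH[OF this] show False using times_cord_strict_mono[OF assms, of "\<alpha> * \<beta>" \<beta>] by simp
    qed
  qed
  then have ex: "\<exists>\<kappa>. \<gamma> < \<alpha> * \<kappa> + \<alpha>"
    by (metis assms le_less_trans plus_cord_less_iff plus_zero_cord)
  define \<kappa> where "\<kappa> = (LEAST \<kappa>. \<gamma> < \<alpha> * \<kappa> + \<alpha>)"
  have 1: "\<gamma> < \<alpha> * \<kappa> + \<alpha>" unfolding \<kappa>_def by (rule LeastI_ex[OF ex])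
  have "\<alpha> * \<kappa> \<le> \<gamma>"
  proof (rule times_cord_least)
    fix \<delta> assume "\<delta> < \<kappa>"
    then show "\<alpha> * \<delta> + \<alpha> \<le> \<gamma>" using not_less_Least[of \<delta>] unfolding \<kappa>_def by force
  qed
  from cord_plus_minus[OF this] 1 show "\<exists>\<rho>. \<rho> < \<alpha> \<and> (\<exists>\<kappa>. \<gamma> = \<alpha> * \<kappa> + \<rho>)"
    by (metis plus_cord_less_iff)
next
  fix \<rho> \<rho>'
  assume "\<rho> < \<alpha> \<and> (\<exists>\<kappa>. \<gamma> = \<alpha> * \<kappa> + \<rho>)" "\<rho>' < \<alpha> \<and> (\<exists>\<kappa>. \<gamma> = \<alpha> * \<kappa> + \<rho>')"
  then obtain \<kappa> \<kappa>' where *: "\<rho> < \<alpha>" "\<rho>' < \<alpha>" "\<gamma> = \<alpha> * \<kappa> + \<rho>" "\<gamma> = \<alpha> * \<kappa>' + \<rho>'" by blast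
  have no: "\<not> \<kappa>1 < \<kappa>2" if "\<rho>1 < \<alpha>" "\<alpha> * \<kappa>1 + \<rho>1 = \<alpha> * \<kappa>2 + \<rho>2" for \<kappa>1 \<kappa>2 \<rho>1 \<rho>2
  proof
    assume "\<kappa>1 < \<kappa>2"
    have "\<alpha> * \<kappa>1 + \<rho>1 < \<alpha> * \<kappa>1 + \<alpha>" using that(1) by simp
    also have "\<dots> \<le> \<alpha> * \<kappa>2" by (rule times_cord_props) fact
    also have "\<dots> \<le> \<alpha> * \<kappa>2 + \<rho>2" by simp
    finally show False using that by simp
  qed
  have "\<kappa> = \<kappa>'" using no[of \<rho> \<kappa> \<kappa>' \<rho>'] no[of \<rho>' \<kappa>' \<kappa> \<rho>] * by (metis linorder_neq_iff)
  with * show "\<rho> = \<rho>'" by simp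
qed

lemma cord_mod_less: "0 < \<alpha> \<Longrightarrow> cord_mod \<gamma> \<alpha> < \<alpha>"
  using theI'[OF cord_mod_ex1[of \<alpha> \<gamma>]] unfolding cord_mod_def by blast


section \<open>Words\<close>

text \<open>
  A word of length \<open>\<alpha>\<close> is a function on \<open>{..<\<alpha>}\<close>; outside this set, \<open>letter\<close> takes the value
  \<^const>\<open>undefined\<close>, so that words are equal iff they have the same length and the same letters.
\<close>

datatype 'a word = Word (len: cord) (letter: "cord \<Rightarrow> 'a set")

text \<open>
  All words have positive length: the letter at position 0 has to exist for the satisfaction
  relation to make sense.
\<close>

definition words :: "'a set \<Rightarrow> 'a word set" where
  "words AP = {w. 0 < len w \<and> letter w \<in> {..<len w} \<rightarrow>\<^sub>E Pow AP}"

definition suffix :: "'a word \<Rightarrow> cord \<Rightarrow> 'a word" where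
  "suffix w \<beta> = Word (len w - \<beta>) (\<lambda>\<gamma>\<in>{..<len w - \<beta>}. letter w (\<beta> + \<gamma>))"

definition concat_word :: "'a word \<Rightarrow> 'a word \<Rightarrow> 'a word" where
  "concat_word u v = Word (len u + len v)
     (\<lambda>\<gamma>\<in>{..<len u + len v}. if \<gamma> < len u then letter u \<gamma> else letter v (\<gamma> - len u))"

definition omega_power :: "'a word \<Rightarrow> 'a word" where
  "omega_power u = Word (len u * omega)
     (\<lambda>\<gamma>\<in>{..<len u * omega}. letter u (cord_mod \<gamma> (len u)))"


section \<open>Linear temporal logic\<close>

datatype (atoms: 'a) ltl =
    Top
  | Atom 'a
  | Neg "'a ltl"
  | Conj "'a ltl" "'a ltl"
  | Next "'a ltl"
  | Finally "'a ltl"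
  | Until "'a ltl" "'a ltl"

primrec sat :: "'a word \<Rightarrow> 'a ltl \<Rightarrow> bool" where
  "sat w Top \<longleftrightarrow> True"
| "sat w (Atom p) \<longleftrightarrow> p \<in> letter w 0"
| "sat w (Neg \<phi>) \<longleftrightarrow> \<not> sat w \<phi>"
| "sat w (Conj \<phi> \<psi>) \<longleftrightarrow> sat w \<phi> \<and> sat w \<psi>"
| "sat w (Next \<phi>) \<longleftrightarrow> 1 < len w \<and> sat (suffix w 1) \<phi>"
| "sat w (Finally \<phi>) \<longleftrightarrow> (\<exists>\<alpha><len w. sat (suffix w \<alpha>) \<phi>)"
| "sat w (Until \<phi> \<psi>) \<longleftrightarrow>
     (\<exists>\<gamma><len w. sat (suffix w \<gamma>) \<psi> \<and> (\<forall>\<beta><\<gamma>. sat (suffix w \<beta>) \<phi>))"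

definition language :: "'a set \<Rightarrow> 'a ltl \<Rightarrow> 'a word set" where
  "language AP \<phi> = {w \<in> words AP. sat w \<phi>}"


section \<open>Finitely presentable words\<close>

datatype (letters: 'l) wexpr =
    Letter 'l
  | Concat "'l wexpr" "'l wexpr"
  | OmegaPower "'l wexpr"

primrec denote :: "'a set wexpr \<Rightarrow> 'a word" where
  "denote (Letter \<sigma>) = Word 1 (\<lambda>\<gamma>\<in>{..<1}. \<sigma>)"
| "denote (Concat A B) = concat_word (denote A) (denote B)"
| "denote (OmegaPower A) = omega_power (denote A)"

definition finitely_presentable :: "'a set \<Rightarrow> 'a word \<Rightarrow> bool" where
  "finitely_presentable AP w \<longleftrightarrow> (\<exists>A. letters A \<subseteq> Pow AP \<and> denote A = w)"

lemma suffix_in_words: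
  assumes "w \<in> words AP" "\<beta> < len w"
  shows "suffix w \<beta> \<in> words AP"
proof -
  have eq: "\<beta> + (len w - \<beta>) = len w" using assms(2) by (simp add: cord_plus_minus)
  then have "0 < len w - \<beta>"
    using assms(2) by (metis plus_zero_cord plus_cord_less_iff)
  moreover have "\<beta> + \<gamma> < len w" if "\<gamma> < len w - \<beta>" for \<gamma>
    using that eq by (metis plus_cord_less_iff)
  ultimately show ?thesis
    using assms(1) by (fastforce simp: words_def suffix_def PiE_iff)
qed

lemma denote_in_words: "letters A \<subseteq> Pow AP \<Longrightarrow> denote A \<in> words AP"
proof (induction A)
  case (Letter \<sigma>)
  then show ?case by (auto simp: words_def less_one_cord_iff[of 0])
next
  case (Concat A B)
  then have A: "denote A \<in> words AP" and B: "denote B \<in> words AP" by auto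
  have "0 < len (denote A) + len (denote B)"
    using A le_plus_cord less_le_trans by (fastforce simp: words_def)
  moreover have "\<gamma> - len (denote A) < len (denote B)"
    if "\<gamma> < len (denote A) + len (denote B)" "\<not> \<gamma> < len (denote A)" for \<gamma>
    using that cord_plus_minus[of "len (denote A)" \<gamma>] by (metis not_less plus_cord_less_iff)
  ultimately show ?case
    using A B by (simp add: words_def concat_word_def PiE_iff)
next
  case (OmegaPower A)
  then have "denote A \<in> words AP" by auto
  then show ?case
    by (auto simp: words_def omega_power_def PiE_iff times_omega_pos cord_mod_less)
qed

end

theory Submission
  imports Defs "HOL-Library.Ramsey"
begin

text \<open>
  Call two words equivalent if, followed by any continuation, they satisfy the same subformulas of
  \<open>\<chi> = \<phi> \<and> \<not> \<psi>\<close>. What a word does to a continuation depends only on the subformulas that the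
  continuation satisfies, so there are finitely many classes and concatenation respects them. So
  do products of \<open>\<omega>\<close>-sequences, by induction on the formula. Every word is then equivalent to a
  finitely presentable one, by induction on its length: at a limit, Ramsey's theorem cuts the word
  into a first factor followed by an \<open>\<omega>\<close>-sequence of pairwise equivalent factors, and all of the
  latter may be replaced by one finitely presentable word.
\<close>

section \<open>Countable ordinals\<close>

lemma zero_plus_cord: "0 + \<alpha> = (\<alpha>::cord)"
proof (induction \<alpha> rule: less_induct)
  case (less \<alpha>)
  have "0 + \<alpha> \<le> \<alpha>" by (rule plus_cord_least) (auto simp: less)
  then show ?case using le_plus_cord_right[of \<alpha> 0] by simp
qed

text \<open>Induction on \<gamma>, with each inequality obtained from the minimality of a sum. In
  the second one, a \<delta> below \<beta> + \<gamma> is either below \<beta> or \<beta> +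
  \<epsilon> with \<epsilon> < \<gamma>, where the induction hypothesis applies.\<close>

lemma plus_cord_assoc: "(\<alpha> + \<beta>) + \<gamma> = \<alpha> + (\<beta> + (\<gamma>::cord))"
proof (induction \<gamma> rule: less_induct)
  case (less \<gamma>)
  show ?case
  proof (rule antisym)
    show "(\<alpha> + \<beta>) + \<gamma> \<le> \<alpha> + (\<beta> + \<gamma>)"
    proof (rule plus_cord_least)
      show "\<alpha> + \<beta> \<le> \<alpha> + (\<beta> + \<gamma>)" by (metis le_plus_cord not_less plus_cord_less_iff)
    qed (simp add: less)
    show "\<alpha> + (\<beta> + \<gamma>) \<le> (\<alpha> + \<beta>) + \<gamma>"
    proof (rule plus_cord_least)
      show "\<alpha> \<le> (\<alpha> + \<beta>) + \<gamma>" by (meson le_plus_cord order_trans)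
      fix \<delta> assume \<delta>: "\<delta> < \<beta> + \<gamma>"
      show "\<alpha> + \<delta> < (\<alpha> + \<beta>) + \<gamma>"
      proof (cases "\<delta> < \<beta>")
        case True
        then show ?thesis by (meson le_plus_cord less_le_trans plus_cord_less_iff)
      next
        case False
        then obtain \<epsilon> where "\<delta> = \<beta> + \<epsilon>" using cord_plus_minus[of \<beta> \<delta>] by (metis not_less)
        with \<delta> show ?thesis using less[of \<epsilon>] by (metis plus_cord_less_iff)
      qed
    qed
  qed
qed

instance cord :: monoid_add
  by standard (simp_all add: plus_cord_assoc zero_plus_cord)

lemma plus_cord_le_iff [simp]: "\<alpha> + \<beta> \<le> \<alpha> + \<gamma> \<longleftrightarrow> \<beta> \<le> (\<gamma>::cord)"
  by (metis not_less plus_cord_less_iff)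

lemma plus_minus_cord [simp]: "\<alpha> + \<beta> - \<alpha> = (\<beta>::cord)"
  using cord_plus_minus[of \<alpha> "\<alpha> + \<beta>"] by simp

lemma plus_plus_minus_cord [simp]: "\<alpha> + (\<beta> + \<gamma>) - (\<alpha> + \<beta>) = (\<gamma>::cord)"
  by (metis plus_minus_cord add.assoc)

lemma minus_zero_cord [simp]: "\<alpha> - 0 = (\<alpha>::cord)"
  using plus_minus_cord[of 0 \<alpha>] by simp

lemma le_cordE:
  assumes "\<beta> \<le> (\<alpha>::cord)"
  obtains \<gamma> where "\<alpha> = \<beta> + \<gamma>"
  using cord_plus_minus[OF assms] by metis

lemma plus_one_le_cord: "\<alpha> < \<beta> \<Longrightarrow> \<alpha> + 1 \<le> (\<beta>::cord)"
  by (metis leI less_plus_one_cord not_less)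

lemma cord_pos_iff: "0 < \<alpha> \<longleftrightarrow> \<alpha> \<noteq> (0::cord)"
  by (metis less_le not_less_zero_cord zero_le_cord)

lemma zero_less_one_cord [simp]: "0 < (1::cord)"
  using one_cord_le_iff by blast

lemma less_plus_cord_iff: "\<alpha> < \<alpha> + \<beta> \<longleftrightarrow> 0 < (\<beta>::cord)"
  by (metis plus_cord_less_iff plus_zero_cord)

lemma cord_plus_eq_0_iff [simp]: "\<alpha> + \<beta> = 0 \<longleftrightarrow> \<alpha> = 0 \<and> \<beta> = (0::cord)"
  by (metis add_0 le_plus_cord le_less not_less_zero_cord)

section \<open>Finite ordinals, multiples by \<omega> and cofinal sequences\<close>

definition cord_of_nat :: "nat \<Rightarrow> cord" where
  "cord_of_nat n = ((\<lambda>\<alpha>. \<alpha> + 1) ^^ n) 0"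

lemma cord_of_nat_simps [simp]:
  "cord_of_nat 0 = 0" "cord_of_nat (Suc n) = cord_of_nat n + 1"
  by (simp_all add: cord_of_nat_def)

lemma cord_of_nat_less_omega: "cord_of_nat n < omega"
  using omega_limit by (induction n) auto

text \<open>An ordinal that is neither zero nor a successor has the closure property of which
  \<open>omega\<close> is the least instance, so it cannot lie below \<open>omega\<close>.\<close>

lemma less_omegaE:
  assumes "\<alpha> < omega"
  obtains n where "\<alpha> = cord_of_nat n"
proof -
  have "\<exists>n. \<alpha> = cord_of_nat n"
    using assms
  proof (induction \<alpha> rule: less_induct)
    case (less \<alpha>)
    show ?case
    proof (cases "0 < \<alpha> \<and> (\<forall>\<delta><\<alpha>. \<delta> + 1 < \<alpha>)")
      case True
      then have "omega \<le> \<alpha>" unfolding omega_def by (rule Least_le)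
      with less.prems show ?thesis by simp
    next
      case False
      then consider "\<alpha> = 0" | \<delta> where "\<delta> < \<alpha>" "\<alpha> = \<delta> + 1"
        using plus_one_le_cord cord_pos_iff by (metis le_less)
      then show ?thesis
      proof cases
        case 1
        then show ?thesis by (metis cord_of_nat_simps(1))
      next
        case 2
        then show ?thesis using less by (metis cord_of_nat_simps(2) less_trans)
      qed
    qed
  qed
  with that show thesis by blast
qed

lemma times_plus_one_cord: "\<alpha> * (\<beta> + 1) = \<alpha> * \<beta> + (\<alpha>::cord)"
proof (rule antisym)
  show "\<alpha> * (\<beta> + 1) \<le> \<alpha> * \<beta> + \<alpha>"
  proof (rule times_cord_least)
    fix \<delta> assume "\<delta> < \<beta> + 1"
    then have "\<delta> \<le> \<beta>" by (simp add: less_plus_one_cord)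
    then consider "\<delta> = \<beta>" | "\<delta> < \<beta>" by force
    then show "\<alpha> * \<delta> + \<alpha> \<le> \<alpha> * \<beta> + \<alpha>"
      by cases (auto intro: order_trans[OF times_cord_props])
  qed
  show "\<alpha> * \<beta> + \<alpha> \<le> \<alpha> * (\<beta> + 1)" by (rule times_cord_props) (simp add: less_plus_one_cord)
qed

text \<open>Otherwise \<gamma> would bound all finite multiples of \<alpha>, hence also their least
  upper bound.\<close>

lemma less_times_omegaE:
  assumes "\<gamma> < \<alpha> * omega"
  obtains n where "\<gamma> < \<alpha> * cord_of_nat n"
proof (rule ccontr)
  assume no: "\<not> thesis"
  have "\<alpha> * omega \<le> \<gamma>"
  proof (rule times_cord_least)
    fix \<delta> assume "\<delta> < omega"
    then obtain n where "\<delta> = cord_of_nat n" by (rule less_omegaE)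
    then have "\<alpha> * \<delta> + \<alpha> = \<alpha> * cord_of_nat (Suc n)" by (simp add: times_plus_one_cord)
    then show "\<alpha> * \<delta> + \<alpha> \<le> \<gamma>" using no that by (metis leI)
  qed
  with assms show False by simp
qed

text \<open>There are only countably many ordinals below \<kappa>. The sequence overtakes them one
  by one, and the limit hypothesis keeps it below \<kappa>.\<close>

lemma cofinal_sequence:
  assumes "\<delta> < \<kappa>" and lim: "\<And>\<alpha>. \<alpha> < \<kappa> \<Longrightarrow> \<alpha> + 1 < (\<kappa>::cord)"
  obtains a :: "nat \<Rightarrow> cord" where "a 0 = \<delta>" "strict_mono a"
    "\<And>n. a n < \<kappa>" "\<And>\<alpha>. \<alpha> < \<kappa> \<Longrightarrow> \<exists>n. \<alpha> < a n"
proof -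
  define e where "e = from_nat_into {..<\<kappa>}"
  have e: "range e = {..<\<kappa>}"
    unfolding e_def using assms(1) by (intro range_from_nat_into countable_lessThan_cord) auto
  define a where "a = rec_nat \<delta> (\<lambda>n \<alpha>. max \<alpha> (e n) + 1)"
  have a: "a 0 = \<delta>" "\<And>n. a (Suc n) = max (a n) (e n) + 1" by (simp_all add: a_def)
  have "e n < \<kappa>" for n
    using e by auto
  then have "a n < \<kappa>" for n
    by (induction n) (simp_all add: a assms)
  moreover have "strict_mono a"
    unfolding strict_mono_Suc_iff by (simp add: a less_plus_one_cord)
  moreover have "\<exists>n. \<alpha> < a n" if "\<alpha> < \<kappa>" for \<alpha>
  proof -
    from that e obtain n where "\<alpha> = e n" by (metis lessThan_iff rangeE)
    then have "\<alpha> < a (Suc n)" by (simp add: a less_plus_one_cord)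
    then show ?thesis ..
  qed
  ultimately show thesis using that a(1) by blast
qed

section \<open>Words\<close>

text \<open>Keeps only the extensionality from \<open>words\<close>: this suffices to compare words
  letter by letter, and it admits the empty word.\<close>

definition wellformed :: "'a word \<Rightarrow> bool" where
  "wellformed w \<longleftrightarrow> letter w \<in> extensional {..<len w}"

definition prefix :: "'a word \<Rightarrow> cord \<Rightarrow> 'a word" where
  "prefix w \<beta> = Word \<beta> (\<lambda>\<gamma>\<in>{..<\<beta>}. letter w \<gamma>)"

lemma word_eqI:
  assumes "wellformed u" "wellformed v" "len u = len v"
    "\<And>\<gamma>. \<gamma> < len v \<Longrightarrow> letter u \<gamma> = letter v \<gamma>"
  shows "u = v"
proof (rule word.expand)
  have "letter u = letter v"
    using assms by (intro extensionalityI[of _ "{..<len v}"]) (auto simp: wellformed_def)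
  with assms(3) show "len u = len v \<and> letter u = letter v" by simp
qed

lemma wellformed_simps [simp]:
  "wellformed (suffix w \<beta>)" "wellformed (prefix w \<beta>)" "wellformed (concat_word u v)"
  "wellformed (omega_power u)" "wellformed (Word \<alpha> (\<lambda>\<gamma>\<in>{..<\<alpha>}. f \<gamma>))"
  by (simp_all add: wellformed_def suffix_def prefix_def concat_word_def omega_power_def)

lemma words_wellformed: "w \<in> words AP \<Longrightarrow> wellformed w"
  by (auto simp: words_def wellformed_def PiE_def)

lemma words_pos: "w \<in> words AP \<Longrightarrow> 0 < len w"
  by (simp add: words_def)

lemma len_simps [simp]:
  "len (suffix w \<beta>) = len w - \<beta>" "len (prefix w \<beta>) = \<beta>"
  "len (concat_word u v) = len u + len v" "len (omega_power u) = len u * omega"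
  by (simp_all add: suffix_def prefix_def concat_word_def omega_power_def)

lemma letter_prefix [simp]: "\<gamma> < \<beta> \<Longrightarrow> letter (prefix w \<beta>) \<gamma> = letter w \<gamma>"
  by (simp add: prefix_def)

lemma letter_suffix:
  assumes "\<beta> + \<gamma> < len w"
  shows "letter (suffix w \<beta>) \<gamma> = letter w (\<beta> + \<gamma>)"
proof -
  have "\<beta> \<le> len w" using assms by (metis le_plus_cord le_less_trans less_imp_le)
  then have "\<gamma> < len w - \<beta>" using assms by (metis cord_plus_minus plus_cord_less_iff)
  then show ?thesis by (simp add: suffix_def)
qed

lemma letter_concat1 [simp]: "\<gamma> < len u \<Longrightarrow> letter (concat_word u v) \<gamma> = letter u \<gamma>"
  using less_le_trans[OF _ le_plus_cord, of \<gamma> "len u" "len v"] by (simp add: concat_word_def)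

lemma letter_concat2 [simp]:
  "\<gamma> < len v \<Longrightarrow> letter (concat_word u v) (len u + \<gamma>) = letter v \<gamma>"
  by (simp add: concat_word_def leD)

lemma suffix_zero: "wellformed w \<Longrightarrow> suffix w 0 = w"
  by (rule word_eqI) (simp_all add: letter_suffix)

lemma suffix_suffix:
  assumes "\<alpha> + \<beta> \<le> len w"
  shows "suffix (suffix w \<alpha>) \<beta> = suffix w (\<alpha> + \<beta>)"
proof -
  \<comment> \<open>Naming the remaining length turns the subtractions into left cancellations. The
    bound may be attained, so the empty suffix is covered.\<close>
  from assms obtain \<gamma> where "len w = \<alpha> + (\<beta> + \<gamma>)" by (metis le_cordE add.assoc)
  then show ?thesis by (intro word_eqI) (simp_all add: letter_suffix add.assoc)
qed

lemma suffix_concat1: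
  assumes "\<beta> \<le> len u"
  shows "suffix (concat_word u v) \<beta> = concat_word (suffix u \<beta>) v"
proof -
  from assms obtain \<gamma> where u: "len u = \<beta> + \<gamma>" by (rule le_cordE)
  show ?thesis
  proof (rule word_eqI)
    fix \<delta> assume "\<delta> < len (concat_word (suffix u \<beta>) v)"
    then have \<delta>: "\<delta> < \<gamma> + len v" by (simp add: u)
    show "letter (suffix (concat_word u v) \<beta>) \<delta> = letter (concat_word (suffix u \<beta>) v) \<delta>"
    proof (cases "\<delta> < \<gamma>")
      case True
      with \<delta> show ?thesis by (simp add: letter_suffix u add.assoc)
    next
      case False
      then obtain \<epsilon> where \<epsilon>: "\<delta> = \<gamma> + \<epsilon>" by (metis le_cordE not_less)
      have "letter (concat_word u v) (\<beta> + \<delta>) = letter v \<epsilon>"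
        using letter_concat2[of \<epsilon> v u] \<delta> by (simp add: u \<epsilon> add.assoc)
      moreover have "letter (concat_word (suffix u \<beta>) v) \<delta> = letter v \<epsilon>"
        using letter_concat2[of \<epsilon> v "suffix u \<beta>"] \<delta> by (simp add: u \<epsilon>)
      ultimately show ?thesis using \<delta> by (simp add: letter_suffix u add.assoc)
    qed
  qed (simp_all add: u add.assoc)
qed

lemma suffix_concat2:
  assumes "\<beta> \<le> len v"
  shows "suffix (concat_word u v) (len u + \<beta>) = suffix v \<beta>"
proof -
  from assms obtain \<gamma> where "len v = \<beta> + \<gamma>" by (rule le_cordE)
  then show ?thesis by (intro word_eqI) (simp_all add: letter_suffix add.assoc)
qed

lemma suffix_concat_len: "wellformed v \<Longrightarrow> suffix (concat_word u v) (len u) = v"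
  using suffix_concat2[of 0 v u] by (simp add: suffix_zero)

lemma concat_prefix_suffix:
  assumes "wellformed w" "\<beta> \<le> len w"
  shows "concat_word (prefix w \<beta>) (suffix w \<beta>) = w"
proof -
  from assms obtain \<gamma> where w: "len w = \<beta> + \<gamma>" by (metis le_cordE)
  show ?thesis
  proof (rule word_eqI)
    fix \<delta> assume \<delta>: "\<delta> < len w"
    show "letter (concat_word (prefix w \<beta>) (suffix w \<beta>)) \<delta> = letter w \<delta>"
    proof (cases "\<delta> < \<beta>")
      case False
      then obtain \<epsilon> where \<epsilon>: "\<delta> = \<beta> + \<epsilon>" by (metis le_cordE not_less)
      then show ?thesis
        using letter_concat2[of \<epsilon> "suffix w \<beta>" "prefix w \<beta>"] \<delta> by (simp add: w letter_suffix)
    qed simp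
  qed (simp_all add: assms w)
qed

lemma concat_word_assoc:
  "concat_word (concat_word u v) w = concat_word u (concat_word v w)"
proof (rule word_eqI)
  fix \<gamma> assume \<gamma>: "\<gamma> < len (concat_word u (concat_word v w))"
  show "letter (concat_word (concat_word u v) w) \<gamma> = letter (concat_word u (concat_word v w)) \<gamma>"
  proof (cases "\<gamma> < len u")
    case True
    then have "\<gamma> < len (concat_word u v)" using le_plus_cord less_le_trans by fastforce
    with True show ?thesis by simp
  next
    case False
    then obtain \<delta> where \<delta>: "\<gamma> = len u + \<delta>" by (metis le_cordE not_less)
    show ?thesis
    proof (cases "\<delta> < len v")
      case True
      then have "\<gamma> < len (concat_word u v)" "\<delta> < len (concat_word v w)"
        using less_le_trans[OF True le_plus_cord] by (simp_all add: \<delta>)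
      then show ?thesis using True by (simp add: \<delta>)
    next
      case False
      then obtain \<epsilon> where \<epsilon>: "\<delta> = len v + \<epsilon>" by (metis le_cordE not_less)
      have "\<epsilon> < len w" using \<gamma> by (simp add: \<delta> \<epsilon>)
      then show ?thesis using letter_concat2[of \<epsilon> w "concat_word u v"] by (simp add: \<delta> \<epsilon> add.assoc)
    qed
  qed
qed (simp_all add: add.assoc)

lemma concat_word_empty:
  assumes "len w = 0" "wellformed z"
  shows "concat_word w z = z" "concat_word z w = z"
proof -
  show "concat_word w z = z" using suffix_concat_len[of z w] assms by (simp add: suffix_zero)
  show "concat_word z w = z" by (rule word_eqI) (simp_all add: assms)
qed

lemma suffix_split:
  assumes "\<beta> + \<gamma> \<le> len w"
  shows "suffix w \<beta> = concat_word (prefix (suffix w \<beta>) \<gamma>) (suffix w (\<beta> + \<gamma>))"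
proof -
  from assms obtain \<delta> where "len w = \<beta> + (\<gamma> + \<delta>)" by (metis le_cordE add.assoc)
  then have "\<gamma> \<le> len (suffix w \<beta>)" by simp
  then show ?thesis using concat_prefix_suffix[of "suffix w \<beta>" \<gamma>] assms by (simp add: suffix_suffix)
qed

lemma prefix_in_words:
  assumes "w \<in> words AP" "0 < \<beta>" "\<beta> \<le> len w"
  shows "prefix w \<beta> \<in> words AP"
  using assms by (auto simp: words_def prefix_def PiE_iff less_le_trans)

text \<open>The empty word is excluded from \<^const>\<open>words\<close>, but it serves as an empty continuation.\<close>

definition empty_word :: "'a word" where
  "empty_word = Word 0 (\<lambda>\<gamma>\<in>{..<0}. {})"

lemma empty_word [simp]: "wellformed empty_word" "len empty_word = 0"
  unfolding empty_word_def by simp_all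

section \<open>Types of words\<close>

primrec subs :: "'a ltl \<Rightarrow> 'a ltl set" where
  "subs Top = {Top}"
| "subs (Atom p) = {Atom p}"
| "subs (Neg \<phi>) = insert (Neg \<phi>) (subs \<phi>)"
| "subs (Conj \<phi> \<psi>) = insert (Conj \<phi> \<psi>) (subs \<phi> \<union> subs \<psi>)"
| "subs (Next \<phi>) = insert (Next \<phi>) (subs \<phi>)"
| "subs (Finally \<phi>) = insert (Finally \<phi>) (subs \<phi>)"
| "subs (Until \<phi> \<psi>) = insert (Until \<phi> \<psi>) (subs \<phi> \<union> subs \<psi>)"

lemma finite_subs [simp]: "finite (subs \<phi>)"
  by (induction \<phi>) auto

lemma subs_self [simp]: "\<phi> \<in> subs \<phi>"
  by (cases \<phi>) auto

lemma subs_trans: "\<eta> \<in> subs \<theta> \<Longrightarrow> \<theta> \<in> subs \<phi> \<Longrightarrow> \<eta> \<in> subs \<phi>"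
  by (induction \<phi>) auto

text \<open>
  Whether a word is empty has to be recorded, since \<open>X\<close> distinguishes the empty continuation
  from the nonempty ones.
\<close>

definition type_of :: "'a ltl \<Rightarrow> 'a word \<Rightarrow> bool \<times> 'a ltl set" where
  "type_of \<phi> w = (len w = 0, {\<theta> \<in> subs \<phi>. sat w \<theta>})"

lemma type_of_eq_iff:
  "type_of \<phi> u = type_of \<phi> v \<longleftrightarrow>
     (len u = 0 \<longleftrightarrow> len v = 0) \<and> (\<forall>\<theta>\<in>subs \<phi>. sat u \<theta> \<longleftrightarrow> sat v \<theta>)"
  by (auto simp: type_of_def)

lemma type_of_eq_sat: "type_of \<phi> u = type_of \<phi> v \<Longrightarrow> \<theta> \<in> subs \<phi> \<Longrightarrow> sat u \<theta> \<longleftrightarrow> sat v \<theta>"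
  by (simp add: type_of_eq_iff)

text \<open>Lets inductions on formulas carry an equality of types down to the subformulas.\<close>

lemma type_of_eq_subs:
  "type_of \<phi> u = type_of \<phi> v \<Longrightarrow> \<theta> \<in> subs \<phi> \<Longrightarrow> type_of \<theta> u = type_of \<theta> v"
  using subs_trans by (auto simp: type_of_eq_iff)

section \<open>Satisfaction in a concatenation\<close>

text \<open>If \<open>y\<close> is a single letter, the next position is the first one of
  \<open>z\<close>, which exists only if \<open>z\<close> is nonempty.\<close>

lemma sat_concat_Next:
  assumes "wellformed z" "0 < len y"
  shows "sat (concat_word y z) (Next \<phi>) \<longleftrightarrow>
    (if len y = 1 then len z \<noteq> 0 \<and> sat z \<phi> else sat (concat_word (suffix y 1) z) \<phi>)"
proof (cases "len y = 1")
  case True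
  then show ?thesis
    using suffix_concat_len[of z y] assms(1) by (simp add: less_plus_cord_iff cord_pos_iff)
next
  case False
  then have "1 < len y" using assms(2) one_cord_le_iff by (metis le_less)
  then show ?thesis using False less_le_trans[OF _ le_plus_cord] by (simp add: suffix_concat1)
qed

text \<open>Positions range over \<open>y\<close> alone, while formulas are evaluated with
  \<open>z\<close> appended. This predicate and \<open>until_within\<close> isolate what
  \<open>y\<close> contributes to an until.\<close>

definition always_within :: "'a word \<Rightarrow> 'a word \<Rightarrow> 'a ltl \<Rightarrow> bool" where
  "always_within y z \<phi> \<longleftrightarrow> (\<forall>\<alpha><len y. sat (concat_word (suffix y \<alpha>) z) \<phi>)"

definition until_within :: "'a word \<Rightarrow> 'a word \<Rightarrow> 'a ltl \<Rightarrow> 'a ltl \<Rightarrow> bool" where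
  "until_within y z \<phi> \<psi> \<longleftrightarrow> (\<exists>\<gamma><len y. sat (concat_word (suffix y \<gamma>) z) \<psi> \<and>
     (\<forall>\<beta><\<gamma>. sat (concat_word (suffix y \<beta>) z) \<phi>))"

text \<open>The witness of the until lies either in \<open>y\<close>, or in \<open>z\<close> after
  all of \<open>y\<close> has been traversed.\<close>

lemma sat_concat_Until:
  assumes "wellformed z"
  shows "sat (concat_word y z) (Until \<phi> \<psi>) \<longleftrightarrow>
    until_within y z \<phi> \<psi> \<or> always_within y z \<phi> \<and> sat z (Until \<phi> \<psi>)"
    (is "?L \<longleftrightarrow> ?R1 \<or> ?R2 \<and> ?R3")
proof
  assume ?L
  then obtain \<gamma> where \<gamma>: "\<gamma> < len y + len z" "sat (suffix (concat_word y z) \<gamma>) \<psi>"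
    "\<And>\<beta>. \<beta> < \<gamma> \<Longrightarrow> sat (suffix (concat_word y z) \<beta>) \<phi>" by auto
  show "?R1 \<or> ?R2 \<and> ?R3"
  proof (cases "\<gamma> < len y")
    case True
    then have "sat (concat_word (suffix y \<beta>) z) \<phi>" if "\<beta> < \<gamma>" for \<beta>
      using \<gamma>(3)[OF that] that by (simp add: suffix_concat1)
    then show ?thesis using \<gamma>(2) True by (auto simp: until_within_def suffix_concat1)
  next
    case False
    then obtain \<delta> where \<delta>: "\<gamma> = len y + \<delta>" by (metis le_cordE not_less)
    have "sat (suffix z \<beta>) \<phi>" if "\<beta> < \<delta>" for \<beta>
      using \<gamma>(3)[of "len y + \<beta>"] \<gamma>(1) that by (simp add: \<delta> suffix_concat2)
    then have ?R3 using \<gamma>(1,2) by (auto simp: \<delta> suffix_concat2)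
    moreover have "sat (concat_word (suffix y \<beta>) z) \<phi>" if "\<beta> < len y" for \<beta>
      using \<gamma>(3)[of \<beta>] that False by (simp add: suffix_concat1)
    ultimately show ?thesis by (simp add: always_within_def)
  qed
next
  assume "?R1 \<or> ?R2 \<and> ?R3"
  then show ?L
  proof (elim disjE conjE)
    assume ?R1
    then obtain \<gamma> where \<gamma>: "\<gamma> < len y" "sat (concat_word (suffix y \<gamma>) z) \<psi>"
      "\<And>\<beta>. \<beta> < \<gamma> \<Longrightarrow> sat (concat_word (suffix y \<beta>) z) \<phi>" by (auto simp: until_within_def)
    have "sat (suffix (concat_word y z) \<beta>) \<phi>" if "\<beta> < \<gamma>" for \<beta>
      using \<gamma>(3)[OF that] \<gamma>(1) that by (simp add: suffix_concat1)
    moreover have "\<gamma> < len (concat_word y z)"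
      using less_le_trans[OF \<gamma>(1) le_plus_cord] by simp
    ultimately show ?L using \<gamma>(1,2) by (auto simp: suffix_concat1)
  next
    assume ?R2 and ?R3
    then obtain \<delta> where \<delta>: "\<delta> < len z" "sat (suffix z \<delta>) \<psi>"
      "\<And>\<beta>. \<beta> < \<delta> \<Longrightarrow> sat (suffix z \<beta>) \<phi>" by auto
    have "sat (suffix (concat_word y z) \<beta>) \<phi>" if "\<beta> < len y + \<delta>" for \<beta>
    proof (cases "\<beta> < len y")
      case True
      then show ?thesis using \<open>?R2\<close> by (simp add: always_within_def suffix_concat1)
    next
      case False
      then obtain \<epsilon> where "\<beta> = len y + \<epsilon>" by (metis le_cordE not_less)
      then show ?thesis using \<delta> that by (simp add: suffix_concat2)
    qed
    moreover have "len y + \<delta> < len (concat_word y z)"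
      "sat (suffix (concat_word y z) (len y + \<delta>)) \<psi>"
      using \<delta> by (simp_all add: suffix_concat2)
    ultimately show ?L unfolding sat.simps by blast
  qed
qed

text \<open>Reduces the treatment of \<open>Finally\<close> in concatenations and products to that
  of \<open>Until\<close>.\<close>

lemma sat_Finally_iff_Until: "sat w (Finally \<phi>) \<longleftrightarrow> sat w (Until Top \<phi>)"
  by simp

lemma sat_concat_Finally:
  assumes "wellformed z"
  shows "sat (concat_word y z) (Finally \<phi>) \<longleftrightarrow>
    (\<exists>\<alpha><len y. sat (concat_word (suffix y \<alpha>) z) \<phi>) \<or> sat z (Finally \<phi>)"
  unfolding sat_Finally_iff_Until sat_concat_Until[OF assms]
  by (auto simp: until_within_def always_within_def)

text \<open>Induction on \<phi>, using the decompositions above. An empty \<open>y\<close> is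
  treated first, so that in the induction the first letter of \<open>y\<close> decides the
  atoms.\<close>

lemma sat_concat_cong:
  assumes "wellformed z" "wellformed z'" "type_of \<phi> z = type_of \<phi> z'"
  shows "sat (concat_word y z) \<phi> \<longleftrightarrow> sat (concat_word y z') \<phi>"
proof (cases "len y = 0")
  case True
  then show ?thesis using assms by (simp add: concat_word_empty type_of_eq_iff)
next
  case False
  then show ?thesis
    using assms(3)
  proof (induction \<phi> arbitrary: y)
    case (Neg \<phi>)
    then show ?case by (simp add: type_of_eq_iff)
  next
    case (Conj \<phi> \<psi>)
    then show ?case by (simp add: type_of_eq_iff)
  next
    case (Next \<phi>)
    have eq: "type_of \<phi> z = type_of \<phi> z'" using type_of_eq_subs[OF Next.prems(2)] by simp
    then have z: "len z = 0 \<longleftrightarrow> len z' = 0" "sat z \<phi> \<longleftrightarrow> sat z' \<phi>" by (simp_all add: type_of_eq_iff)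
    \<comment> \<open>The induction hypothesis speaks of nonempty words only, so nonemptiness is
      checked for each suffix to which it is applied.\<close>
    have "len (suffix y 1) \<noteq> 0" if "len y \<noteq> 1"
      using Next.prems(1) that cord_plus_minus[of 1 "len y"]
      by (metis add.right_neutral cord_pos_iff len_simps(1) one_cord_le_iff)
    then show ?case
      using Next.IH[OF _ eq, of "suffix y 1"] Next.prems(1) assms(1,2) z
      by (simp add: sat_concat_Next cord_pos_iff del: sat.simps)
  next
    case (Finally \<phi>)
    have eq: "type_of \<phi> z = type_of \<phi> z'" using type_of_eq_subs[OF Finally.prems(2)] by simp
    have "len (suffix y \<alpha>) \<noteq> 0" if "\<alpha> < len y" for \<alpha>
      using that by (metis add.right_neutral cord_plus_minus len_simps(1) less_irrefl less_imp_le)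
    then show ?case
      using Finally.IH[OF _ eq, of "suffix y _"] type_of_eq_sat[OF Finally.prems(2), of "Finally \<phi>"] assms(1,2)
      by (auto simp: sat_concat_Finally simp del: sat.simps)
  next
    case (Until \<phi> \<psi>)
    have eq: "type_of \<phi> z = type_of \<phi> z'" "type_of \<psi> z = type_of \<psi> z'"
      using type_of_eq_subs[OF Until.prems(2)] by simp_all
    have "len (suffix y \<alpha>) \<noteq> 0" if "\<alpha> < len y" for \<alpha>
      using that by (metis add.right_neutral cord_plus_minus len_simps(1) less_irrefl less_imp_le)
    then have within: "sat (concat_word (suffix y \<alpha>) z) \<phi> \<longleftrightarrow> sat (concat_word (suffix y \<alpha>) z') \<phi>"
      "sat (concat_word (suffix y \<alpha>) z) \<psi> \<longleftrightarrow> sat (concat_word (suffix y \<alpha>) z') \<psi>"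
      if "\<alpha> < len y" for \<alpha>
      using Until.IH eq that by blast+
    have "(\<forall>\<beta><\<gamma>. sat (concat_word (suffix y \<beta>) z) \<phi>) \<longleftrightarrow>
        (\<forall>\<beta><\<gamma>. sat (concat_word (suffix y \<beta>) z') \<phi>)" if "\<gamma> < len y" for \<gamma>
      using within(1) less_trans[OF _ that] by blast
    then have "always_within y z \<phi> \<longleftrightarrow> always_within y z' \<phi>"
      "until_within y z \<phi> \<psi> \<longleftrightarrow> until_within y z' \<phi> \<psi>"
      using within by (simp_all add: always_within_def until_within_def cong: conj_cong)
    then show ?case
      using type_of_eq_sat[OF Until.prems(2), of "Until \<phi> \<psi>"] assms(1,2)
      by (simp add: sat_concat_Until del: sat.simps)
  qed (simp_all add: cord_pos_iff)
qed

lemma type_of_concat_cong: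
  assumes "wellformed z" "wellformed z'" "type_of \<phi> z = type_of \<phi> z'"
  shows "type_of \<phi> (concat_word y z) = type_of \<phi> (concat_word y z')"
proof -
  have "sat (concat_word y z) \<theta> \<longleftrightarrow> sat (concat_word y z') \<theta>" if "\<theta> \<in> subs \<phi>" for \<theta>
    using sat_concat_cong[OF assms(1,2) type_of_eq_subs[OF assms(3) that]] .
  then show ?thesis using assms(3) by (simp add: type_of_eq_iff)
qed

lemma within_cong:
  assumes "wellformed z" "wellformed z'" "type_of \<phi> z = type_of \<phi> z'"
  shows "always_within y z \<phi> \<longleftrightarrow> always_within y z' \<phi>"
    and "type_of \<psi> z = type_of \<psi> z' \<Longrightarrow> until_within y z \<phi> \<psi> \<longleftrightarrow> until_within y z' \<phi> \<psi>"
proof -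
  note \<phi> = sat_concat_cong[OF assms]
  then show "always_within y z \<phi> \<longleftrightarrow> always_within y z' \<phi>" by (simp add: always_within_def)
  assume "type_of \<psi> z = type_of \<psi> z'"
  note \<psi> = sat_concat_cong[OF assms(1,2) this]
  show "until_within y z \<phi> \<psi> \<longleftrightarrow> until_within y z' \<phi> \<psi>" by (simp add: until_within_def \<phi> \<psi>)
qed

section \<open>Equivalent words\<close>

text \<open>The quantification over continuations makes this a congruence. The empty continuation is
  among them, so wellformed equivalent words satisfy the same subformulas themselves.\<close>

definition equivalent :: "'a ltl \<Rightarrow> 'a word \<Rightarrow> 'a word \<Rightarrow> bool" where
  "equivalent \<phi> u v \<longleftrightarrow>
     (\<forall>x. wellformed x \<longrightarrow> type_of \<phi> (concat_word u x) = type_of \<phi> (concat_word v x))"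

lemma equivalent_refl: "equivalent \<phi> u u"
  by (simp add: equivalent_def)

lemma equivalent_trans: "equivalent \<phi> u v \<Longrightarrow> equivalent \<phi> v w \<Longrightarrow> equivalent \<phi> u w"
  by (simp add: equivalent_def)

lemma equivalent_sat:
  assumes "equivalent \<phi> u v" "wellformed x" "\<theta> \<in> subs \<phi>"
  shows "sat (concat_word u x) \<theta> \<longleftrightarrow> sat (concat_word v x) \<theta>"
  using assms type_of_eq_sat unfolding equivalent_def by blast

text \<open>The left factor is exchanged before the continuation \<open>concat_word v x\<close>;
  exchanging the right factor changes only a continuation by one of the same type.\<close>

lemma equivalent_concat:
  assumes "equivalent \<phi> u u'" "equivalent \<phi> v v'"
  shows "equivalent \<phi> (concat_word u v) (concat_word u' v')"
  using assms type_of_concat_cong unfolding equivalent_def concat_word_assoc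
  by (metis wellformed_simps(3))

text \<open>
  A word acts on the finitely many types of continuations, and this action determines its
  equivalence class.
\<close>

definition action :: "'a ltl \<Rightarrow> 'a word \<Rightarrow> ((bool \<times> 'a ltl set) \<times> (bool \<times> 'a ltl set)) set" where
  "action \<phi> u = (\<lambda>x. (type_of \<phi> x, type_of \<phi> (concat_word u x))) ` {x. wellformed x}"

lemma finite_range_action: "finite (range (action \<phi>))"
proof (rule finite_subset)
  show "range (action \<phi>) \<subseteq> Pow ((UNIV \<times> Pow (subs \<phi>)) \<times> (UNIV \<times> Pow (subs \<phi>)))"
    by (auto simp: action_def type_of_def)
qed simp

text \<open>The graph is indexed by types, so it yields only some x' of the same type as x;
  \<open>type_of_concat_cong\<close> leads back from x' to x.\<close>

lemma action_eq_imp_equivalent: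
  assumes "action \<phi> u = action \<phi> v"
  shows "equivalent \<phi> u v"
  unfolding equivalent_def
proof (intro allI impI)
  fix x :: "'a word" assume x: "wellformed x"
  then have "(type_of \<phi> x, type_of \<phi> (concat_word u x)) \<in> action \<phi> v"
    unfolding assms[symmetric] by (auto simp: action_def)
  then obtain x' where "wellformed x'" "type_of \<phi> x = type_of \<phi> x'"
    "type_of \<phi> (concat_word u x) = type_of \<phi> (concat_word v x')" by (auto simp: action_def)
  then show "type_of \<phi> (concat_word u x) = type_of \<phi> (concat_word v x)"
    using type_of_concat_cong[OF x] by metis
qed

section \<open>Products of \<open>\<omega>\<close>-sequences of words\<close>

primrec start :: "(nat \<Rightarrow> 'a word) \<Rightarrow> nat \<Rightarrow> cord" where
  "start u 0 = 0"
| "start u (Suc n) = start u n + len (u n)"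

text \<open>The product is not constructed: \<open>s\<close> is given, together with a cofinal
  cutting into nonempty factors. This fits both \<omega>-powers and suffixes cut out of a given
  word.\<close>

locale omega_product =
  fixes u :: "nat \<Rightarrow> 'a word" and s :: "'a word"
  assumes wellformed: "wellformed s"
    and pos: "\<And>n. 0 < len (u n)"
    and start_le: "\<And>n. start u n \<le> len s"
    and factor: "\<And>n. prefix (suffix s (start u n)) (len (u n)) = u n"
    and cofinal: "\<And>\<alpha>. \<alpha> < len s \<Longrightarrow> \<exists>n. \<alpha> < start u n"
begin

text \<open>The product of the factors from index \<open>n\<close> on, followed by \<open>x\<close>.
  Claims about all these tails are what the inductions below need.\<close>

definition rest :: "'a word \<Rightarrow> nat \<Rightarrow> 'a word" where
  "rest x n = concat_word (suffix s (start u n)) x"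

lemma wellformed_rest [simp]: "wellformed (rest x n)"
  by (simp add: rest_def)

lemma rest_0: "rest x 0 = concat_word s x"
  by (simp add: rest_def suffix_zero wellformed)

lemma rest_Suc: "rest x n = concat_word (u n) (rest x (Suc n))"
  using suffix_split[of "start u n" "len (u n)" s] start_le[of "Suc n"]
  by (simp add: rest_def factor concat_word_assoc[symmetric])

lemma len_rest: "len (rest x n) \<noteq> 0"
  using pos[of n] by (subst rest_Suc) (simp add: cord_pos_iff)

lemma start_strict_mono: "strict_mono (start u)"
  unfolding strict_mono_Suc_iff using pos by (simp add: less_plus_cord_iff)

lemma suffix_start:
  assumes "\<beta> < len (u n)"
  shows "concat_word (suffix s (start u n + \<beta>)) x = concat_word (suffix (u n) \<beta>) (rest x (Suc n))"
proof -
  have le: "start u n + \<beta> \<le> len s"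
    using assms start_le[of "Suc n"] by (metis less_imp_le order_trans plus_cord_le_iff start.simps(2))
  then have "\<beta> \<le> len (suffix s (start u n))"
    by (metis cord_plus_minus le_plus_cord len_simps(1) order_trans plus_cord_le_iff)
  then have "concat_word (suffix s (start u n + \<beta>)) x = suffix (rest x n) \<beta>"
    using le by (simp add: rest_def suffix_concat1 suffix_suffix)
  also have "\<dots> = concat_word (suffix (u n) \<beta>) (rest x (Suc n))"
    using assms by (subst rest_Suc) (simp add: suffix_concat1)
  finally show ?thesis .
qed

text \<open>The factor containing \<alpha> is the one just before the first start beyond \<alpha>,
  which exists by cofinality.\<close>

lemma positionE:
  assumes "start u i \<le> \<alpha>" "\<alpha> < len s"
  obtains j \<beta> where "i \<le> j" "\<beta> < len (u j)" "\<alpha> = start u j + \<beta>"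
proof -
  define n where "n = (LEAST n. \<alpha> < start u n)"
  have n: "\<alpha> < start u n" unfolding n_def using cofinal[OF assms(2)] by (rule LeastI_ex)
  then obtain j where j: "n = Suc j" by (cases n) auto
  have "\<not> \<alpha> < start u j" using not_less_Least[of j "\<lambda>n. \<alpha> < start u n"] by (simp add: n_def[symmetric] j)
  then obtain \<beta> where \<beta>: "\<alpha> = start u j + \<beta>" by (metis le_cordE not_less)
  have "start u i < start u n" using assms(1) n by simp
  then have "i < n" using strict_mono_less[OF start_strict_mono] by blast
  then have "i \<le> j" using j by simp
  moreover have "\<beta> < len (u j)" using n by (simp add: j \<beta>)
  ultimately show thesis using that \<beta> by blast
qed

text \<open>Turns positions of a tail into pairs of a factor and an offset. The predicate is
  arbitrary because both satisfaction and its negation are inserted for it.\<close>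

lemma ex_position_iff:
  "(\<exists>\<alpha><len (suffix s (start u i)). P (concat_word (suffix (suffix s (start u i)) \<alpha>) x)) \<longleftrightarrow>
    (\<exists>j\<ge>i. \<exists>\<beta><len (u j). P (concat_word (suffix (u j) \<beta>) (rest x (Suc j))))"
    (is "?L \<longleftrightarrow> ?R")
proof -
  define Q where "Q \<alpha> \<longleftrightarrow> P (concat_word (suffix s \<alpha>) x)" for \<alpha>
  obtain \<kappa> where \<kappa>: "len s = start u i + \<kappa>" "len (suffix s (start u i)) = \<kappa>"
    using le_cordE[OF start_le] by (metis len_simps(1) plus_minus_cord)
  have "(\<exists>\<alpha><\<kappa>. Q (start u i + \<alpha>)) \<longleftrightarrow> (\<exists>j\<ge>i. \<exists>\<beta><len (u j). Q (start u j + \<beta>))"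
    (is "?L' \<longleftrightarrow> ?R'")
  proof
    assume ?L'
    then obtain \<alpha> where "\<alpha> < \<kappa>" "Q (start u i + \<alpha>)" by blast
    then show ?R' using positionE[of i "start u i + \<alpha>"] by (metis \<kappa>(1) le_plus_cord plus_cord_less_iff)
  next
    assume ?R'
    then obtain j \<beta> where j: "j \<ge> i" "\<beta> < len (u j)" "Q (start u j + \<beta>)" by blast
    have "start u i \<le> start u j" using j(1) start_strict_mono by (simp add: strict_mono_less_eq)
    then obtain \<delta> where \<delta>: "start u j + \<beta> = start u i + \<delta>" by (metis le_cordE add.assoc)
    have "start u j + \<beta> < len s"
      using start_le[of "Suc j"] j(2) by (metis less_le_trans plus_cord_less_iff start.simps(2))
    then have "\<delta> < \<kappa>" by (simp add: \<delta> \<kappa>(1))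
    then show ?L' using j(3) \<delta> by auto
  qed
  moreover have "Q (start u i + \<alpha>) \<longleftrightarrow> P (concat_word (suffix (suffix s (start u i)) \<alpha>) x)"
    if "\<alpha> < \<kappa>" for \<alpha>
    using that by (simp add: Q_def suffix_suffix \<kappa>(1))
  moreover have "Q (start u j + \<beta>) \<longleftrightarrow> P (concat_word (suffix (u j) \<beta>) (rest x (Suc j)))"
    if "\<beta> < len (u j)" for j \<beta>
    using that by (simp add: Q_def suffix_start)
  ultimately show ?thesis unfolding \<kappa>(2) by (metis (no_types, lifting))
qed

lemma always_within_suffix_start:
  "always_within (suffix s (start u i)) x \<phi> \<longleftrightarrow> (\<forall>k\<ge>i. always_within (u k) (rest x (Suc k)) \<phi>)"
  unfolding always_within_def using ex_position_iff[of i "\<lambda>w. \<not> sat w \<phi>" x] by blast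

text \<open>Unfolding the until factor by factor may go on forever. In that case no position of the
  tail of \<open>s\<close> is a witness, so the witness lies in \<open>x\<close>.\<close>

lemma sat_rest_Until:
  assumes x: "wellformed x"
  shows "sat (rest x i) (Until \<phi> \<psi>) \<longleftrightarrow>
    (\<exists>j\<ge>i. until_within (u j) (rest x (Suc j)) \<phi> \<psi> \<and>
       (\<forall>k\<in>{i..<j}. always_within (u k) (rest x (Suc k)) \<phi>)) \<or>
    (\<forall>k\<ge>i. always_within (u k) (rest x (Suc k)) \<phi>) \<and> sat x (Until \<phi> \<psi>)"
    (is "_ \<longleftrightarrow> ?R1 i \<or> ?R2")
proof
  have unfold: "sat (rest x k) (Until \<phi> \<psi>) \<longleftrightarrow> until_within (u k) (rest x (Suc k)) \<phi> \<psi> \<or>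
      always_within (u k) (rest x (Suc k)) \<phi> \<and> sat (rest x (Suc k)) (Until \<phi> \<psi>)" for k
    by (subst rest_Suc) (simp add: sat_concat_Until del: sat.simps)
  {
    assume L: "sat (rest x i) (Until \<phi> \<psi>)"
    show "?R1 i \<or> ?R2"
    proof (cases "?R1 i")
      case True
      then show ?thesis ..
    next
      case no: False
      \<comment> \<open>As no factor fulfils the until, the obligation is handed on from each factor
        to the next.\<close>
      have "sat (rest x k) (Until \<phi> \<psi>) \<and> (\<forall>m\<in>{i..<k}. always_within (u m) (rest x (Suc m)) \<phi>)"
        if "i \<le> k" for k
        using that
      proof (induction k rule: dec_induct)
        case base
        then show ?case using L by simp
      next
        case (step k)
        then show ?case using unfold[of k] no
          by (auto simp: less_Suc_eq simp del: sat.simps)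
      qed
      then have always: "\<forall>k\<ge>i. always_within (u k) (rest x (Suc k)) \<phi>"
        by (meson atLeastLessThan_iff le_Suc_eq lessI)
      \<comment> \<open>A position satisfying \<psi> in factor \<open>j\<close> would fulfil the
        until there, since \<phi> holds throughout this factor and all earlier ones.\<close>
      have "\<not> sat (concat_word (suffix (u j) \<beta>) (rest x (Suc j))) \<psi>"
        if "j \<ge> i" "\<beta> < len (u j)" for j \<beta>
        using no always that less_trans[OF _ that(2)]
        unfolding always_within_def until_within_def by (metis atLeastLessThan_iff)
      then have "\<not> until_within (suffix s (start u i)) x \<phi> \<psi>"
        using ex_position_iff[of i "\<lambda>w. sat w \<psi>" x] unfolding until_within_def by blast
      then have "sat x (Until \<phi> \<psi>)"
        using L unfolding rest_def[of x i] sat_concat_Until[OF x] by blast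
      with always show ?thesis by blast
    qed
  next
    assume "?R1 i \<or> ?R2"
    then show "sat (rest x i) (Until \<phi> \<psi>)"
    proof
      assume "?R1 i"
      then obtain j where j: "i \<le> j" "until_within (u j) (rest x (Suc j)) \<phi> \<psi>"
        and always: "\<forall>k\<in>{i..<j}. always_within (u k) (rest x (Suc k)) \<phi>" by blast
      from j(1) show ?thesis
      proof (induction rule: inc_induct)
        case base
        show ?case using j(2) unfold by blast
      next
        case (step k)
        then have "k \<in> {i..<j}" by simp
        then show ?case using always unfold[of k] step.IH by blast
      qed
    next
      assume ?R2
      then show ?thesis
        unfolding rest_def[of x i] sat_concat_Until[OF x] always_within_suffix_start by (rule disjI2)
    qed
  }
qed

end

section \<open>Exchanging all factors of a product\<close>

text \<open>\<open>transfer\<close> exchanges one factor before a fixed continuation; the equalities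
  of types exchange the tails. The hypotheses are symmetric in the two products, so one direction is
  enough.\<close>

lemma omega_product_Until_transfer:
  assumes "omega_product u s" "omega_product v t"
    and transfer: "\<And>n z. wellformed z \<Longrightarrow>
      sat (concat_word (u n) z) (Until \<theta> \<eta>) \<longleftrightarrow> sat (concat_word (v n) z) (Until \<theta> \<eta>)"
    and x: "wellformed x"
    and \<theta>: "\<And>n. type_of \<theta> (omega_product.rest u s x n) = type_of \<theta> (omega_product.rest v t x n)"
    and \<eta>: "\<And>n. type_of \<eta> (omega_product.rest u s x n) = type_of \<eta> (omega_product.rest v t x n)"
    and sat: "sat (omega_product.rest u s x i) (Until \<theta> \<eta>)"
  shows "sat (omega_product.rest v t x i) (Until \<theta> \<eta>)"
proof -
  interpret u: omega_product u s by fact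
  interpret v: omega_product v t by fact
  let ?A = "\<lambda>w z. always_within w z \<theta>" and ?U = "\<lambda>w z. until_within w z \<theta> \<eta>"
  have within_eq: "?A w (u.rest x n) \<longleftrightarrow> ?A w (v.rest x n)" "?U w (u.rest x n) \<longleftrightarrow> ?U w (v.rest x n)"
    for w n by (simp_all add: within_cong[OF _ _ \<theta>] \<eta>)
  from sat consider
    j where "i \<le> j" "?U (u j) (u.rest x (Suc j))" "\<forall>k\<in>{i..<j}. ?A (u k) (u.rest x (Suc k))"
    | "\<forall>k\<ge>i. ?A (u k) (u.rest x (Suc k))" "sat x (Until \<theta> \<eta>)"
    unfolding u.sat_rest_Until[OF x] by blast
  then show ?thesis
  proof cases
    case 1
    \<comment> \<open>With a witness in factor \<open>j\<close>, the factors are exchanged one at a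
      time, going backwards from \<open>j\<close> to \<open>i\<close>.\<close>
    from 1(1) show ?thesis
    proof (induction rule: inc_induct)
      case base
      have "sat (concat_word (u j) (v.rest x (Suc j))) (Until \<theta> \<eta>)"
        using 1(2) by (simp add: sat_concat_Until within_eq del: sat.simps)
      then show ?case by (simp add: transfer v.rest_Suc[symmetric] del: sat.simps)
    next
      case (step k)
      have "sat (concat_word (u k) (v.rest x (Suc k))) (Until \<theta> \<eta>)"
        using 1(3) step by (simp add: sat_concat_Until within_eq del: sat.simps)
      then show ?case by (simp add: transfer v.rest_Suc[symmetric] del: sat.simps)
    qed
  next
    case 2
    \<comment> \<open>Each \<open>v k\<close> is compared to \<open>u k\<close> before the continuation \<open>u.rest x (Suc k)\<close>, which is known to
      satisfy the formula; comparing before \<open>v.rest x (Suc k)\<close> would be circular.\<close>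
    have *: "?U (v k) (v.rest x (Suc k)) \<or> ?A (v k) (v.rest x (Suc k))" if "i \<le> k" for k
    proof -
      have "sat (u.rest x k) (Until \<theta> \<eta>)" unfolding u.sat_rest_Until[OF x] using 2 that by auto
      then have "sat (concat_word (v k) (u.rest x (Suc k))) (Until \<theta> \<eta>)"
        by (subst (asm) u.rest_Suc) (simp add: transfer del: sat.simps)
      then show ?thesis by (auto simp: sat_concat_Until within_eq simp del: sat.simps)
    qed
    show ?thesis
    proof (cases "\<forall>k\<ge>i. ?A (v k) (v.rest x (Suc k))")
      case True
      then show ?thesis unfolding v.sat_rest_Until[OF x] using 2(2) by blast
    next
      case False
      \<comment> \<open>By \<open>*\<close>, the first factor in which \<theta> does not hold
        throughout contains a witness of the until.\<close>
      define j where "j = (LEAST k. i \<le> k \<and> \<not> ?A (v k) (v.rest x (Suc k)))"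
      have j: "i \<le> j" "\<not> ?A (v j) (v.rest x (Suc j))"
        using LeastI_ex[of "\<lambda>k. i \<le> k \<and> \<not> ?A (v k) (v.rest x (Suc k))"] False
        unfolding j_def by blast+
      have "?A (v k) (v.rest x (Suc k))" if "k \<in> {i..<j}" for k
        using not_less_Least[of k "\<lambda>k. i \<le> k \<and> \<not> ?A (v k) (v.rest x (Suc k))"] that
        unfolding j_def by auto
      then show ?thesis unfolding v.sat_rest_Until[OF x] using j * by blast
    qed
  qed
qed

text \<open>Induction on \<theta> for all tails at once: \<open>Next\<close> may move into the
  following tail, and \<open>Until\<close> refers to all later ones. No tail is empty, so types
  differ at most in the formulas satisfied.\<close>

lemma omega_product_type_of:
  assumes prod: "omega_product u s" "omega_product v t"
    and eqv: "\<And>n. equivalent \<phi> (u n) (v n)"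
    and x: "wellformed x" and "\<theta> \<in> subs \<phi>"
  shows "type_of \<theta> (omega_product.rest u s x n) = type_of \<theta> (omega_product.rest v t x n)"
proof -
  interpret u: omega_product u s by fact
  interpret v: omega_product v t by fact
  note len = u.len_rest v.len_rest
  have transfer: "sat (concat_word (u n) z) \<theta> \<longleftrightarrow> sat (concat_word (v n) z) \<theta>"
    if "\<theta> \<in> subs \<phi>" "wellformed z" for n z \<theta>
    using equivalent_sat[OF eqv that(2,1)] .
  have sat_Until: "sat (u.rest x n) (Until \<theta> \<eta>) \<longleftrightarrow> sat (v.rest x n) (Until \<theta> \<eta>)"
    if "\<And>n z. wellformed z \<Longrightarrow>
      sat (concat_word (u n) z) (Until \<theta> \<eta>) \<longleftrightarrow> sat (concat_word (v n) z) (Until \<theta> \<eta>)"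
    and "\<And>n. type_of \<theta> (u.rest x n) = type_of \<theta> (v.rest x n)"
    and "\<And>n. type_of \<eta> (u.rest x n) = type_of \<eta> (v.rest x n)" for \<theta> \<eta> n
    using omega_product_Until_transfer[OF prod that(1) x that(2,3)]
      omega_product_Until_transfer[OF prod(2,1) that(1)[symmetric] x that(2,3)[symmetric]]
    by blast
  show ?thesis
    using assms(5)
  proof (induction \<theta> arbitrary: n)
    case Top
    show ?case by (simp add: type_of_eq_iff len)
  next
    case (Atom p)
    have "sat (u.rest x n) (Atom p) \<longleftrightarrow> sat (v.rest x n) (Atom p)"
      using transfer[OF Atom, of "u.rest x (Suc n)" n] u.pos v.pos
      by (subst u.rest_Suc, subst v.rest_Suc) simp
    then show ?case by (simp add: type_of_eq_iff len)
  next
    case (Neg \<theta>)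
    then show ?case using subs_trans[OF _ Neg.prems] by (auto simp: type_of_eq_iff len)
  next
    case (Conj \<theta> \<eta>)
    then show ?case using subs_trans[OF _ Conj.prems] by (auto simp: type_of_eq_iff)
  next
    case (Next \<theta>)
    have \<theta>: "type_of \<theta> (u.rest x n) = type_of \<theta> (v.rest x n)" for n
      using Next.IH subs_trans[OF _ Next.prems] by simp
    \<comment> \<open>The first factor is exchanged by equivalence, before an unchanged tail. Then
      the tail is exchanged, which only needs its type for \<theta>.\<close>
    have "sat (u.rest x n) (Next \<theta>) \<longleftrightarrow> sat (concat_word (v n) (u.rest x (Suc n))) (Next \<theta>)"
      using transfer[OF Next.prems] by (subst u.rest_Suc) simp
    also have "\<dots> \<longleftrightarrow> sat (concat_word (v n) (v.rest x (Suc n))) (Next \<theta>)"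
      using sat_concat_cong[OF _ _ \<theta>[of "Suc n"]] type_of_eq_sat[OF \<theta>[of "Suc n"], of \<theta>]
        v.pos[of n] len
      by (simp add: sat_concat_Next del: sat.simps)
    finally have "sat (u.rest x n) (Next \<theta>) \<longleftrightarrow> sat (v.rest x n) (Next \<theta>)"
      by (simp add: v.rest_Suc[symmetric] del: sat.simps)
    then show ?case using \<theta>[of n] by (simp add: type_of_eq_iff del: sat.simps)
  next
    case (Finally \<theta>)
    have \<theta>: "type_of \<theta> (u.rest x n) = type_of \<theta> (v.rest x n)" for n
      using Finally.IH subs_trans[OF _ Finally.prems] by simp
    have "sat (u.rest x n) (Finally \<theta>) \<longleftrightarrow> sat (v.rest x n) (Finally \<theta>)"
      unfolding sat_Finally_iff_Until
    proof (rule sat_Until)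
      show "sat (concat_word (u n) z) (Until Top \<theta>) \<longleftrightarrow> sat (concat_word (v n) z) (Until Top \<theta>)"
        if "wellformed z" for n z
        using transfer[OF Finally.prems that] by (simp only: sat_Finally_iff_Until)
    qed (simp_all add: \<theta> type_of_eq_iff len)
    then show ?case using \<theta>[of n] by (simp add: type_of_eq_iff del: sat.simps)
  next
    case (Until \<theta> \<eta>)
    have IH: "type_of \<theta> (u.rest x n) = type_of \<theta> (v.rest x n)"
      "type_of \<eta> (u.rest x n) = type_of \<eta> (v.rest x n)" for n
      using Until.IH subs_trans[OF _ Until.prems] by simp_all
    have "sat (u.rest x n) (Until \<theta> \<eta>) \<longleftrightarrow> sat (v.rest x n) (Until \<theta> \<eta>)"
      using sat_Until[OF transfer[OF Until.prems] IH] .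
    then show ?case using IH[of n] by (auto simp: type_of_eq_iff simp del: sat.simps)
  qed
qed

lemma omega_product_equivalent:
  assumes "omega_product u s" "omega_product v t" "\<And>n. equivalent \<phi> (u n) (v n)"
  shows "equivalent \<phi> s t"
  unfolding equivalent_def
proof (intro allI impI)
  fix x :: "'a word" assume "wellformed x"
  from omega_product_type_of[OF assms this subs_self, of 0]
  show "type_of \<phi> (concat_word s x) = type_of \<phi> (concat_word t x)"
    using assms(1,2) by (simp add: omega_product.rest_0)
qed

section \<open>\<omega>-powers and cut suffixes as products\<close>

text \<open>Factor \<open>n\<close> starts at \<open>len u * cord_of_nat n\<close>. Uniqueness of
  remainders identifies its letters, and \<open>less_times_omegaE\<close> gives cofinality.\<close>

lemma omega_product_omega_power:
  assumes "wellformed u" "0 < len u"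
  shows "omega_product (\<lambda>_. u) (omega_power u)"
proof
  have start: "start (\<lambda>_. u) n = len u * cord_of_nat n" for n
    by (induction n) (simp_all add: times_plus_one_cord)
  fix n
  show le: "start (\<lambda>_. u) n \<le> len (omega_power u)" for n
    using times_cord_strict_mono[OF assms(2) cord_of_nat_less_omega] by (simp add: start less_imp_le)
  let ?p = "start (\<lambda>_. u) n"
  show "prefix (suffix (omega_power u) ?p) (len u) = u"
  proof (rule word_eqI)
    fix \<gamma> assume \<gamma>: "\<gamma> < len u"
    have "?p + \<gamma> < start (\<lambda>_. u) (Suc n)" using \<gamma> by simp
    then have less: "?p + \<gamma> < len (omega_power u)" using le less_le_trans by blast
    have "cord_mod (?p + \<gamma>) (len u) = \<gamma>"
      unfolding cord_mod_def using \<gamma> by (intro the1_equality cord_mod_ex1 assms) (auto simp: start)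
    with less \<gamma> show "letter (prefix (suffix (omega_power u) ?p) (len u)) \<gamma> = letter u \<gamma>"
      by (simp add: letter_suffix) (simp add: omega_power_def)
  qed (simp_all add: assms)
  show "\<exists>n. \<alpha> < start (\<lambda>_. u) n" if "\<alpha> < len (omega_power u)" for \<alpha>
    using that by (auto simp: start elim: less_times_omegaE)
qed (use assms in auto)

text \<open>The part of \<open>w\<close> before \<open>b 0\<close> is left out, because a
  homogeneous choice of cuts need not begin at the start of the word.\<close>

lemma omega_product_suffix:
  fixes b :: "nat \<Rightarrow> cord"
  assumes "strict_mono b" "\<And>n. b n < len w" "\<And>\<alpha>. \<alpha> < len w \<Longrightarrow> \<exists>n. \<alpha> < b n"
  shows "omega_product (\<lambda>n. prefix (suffix w (b n)) (b (Suc n) - b n)) (suffix w (b 0))"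
    (is "omega_product ?u ?s")
proof
  have diff: "b n + (b (Suc n) - b n) = b (Suc n)" for n
    using assms(1) by (simp add: cord_plus_minus strict_mono_less_eq)
  \<comment> \<open>The lengths of the factors telescope.\<close>
  have start: "b 0 + start ?u n = b n" for n
    by (induction n) (simp_all add: diff add.assoc[symmetric])
  have len: "b 0 + len ?s = len w"
    using assms(2)[of 0] by (simp add: cord_plus_minus)
  fix n
  have "b n < b n + (b (Suc n) - b n)" using assms(1) diff by (simp add: strict_mono_less)
  then show "0 < len (?u n)" by (simp add: less_plus_cord_iff)
  show "start ?u n \<le> len ?s"
    by (metis assms(2) len less_imp_le plus_cord_le_iff start)
  show "prefix (suffix ?s (start ?u n)) (len (?u n)) = ?u n"
    using assms(2)[of n] by (simp add: suffix_suffix start)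
  show "\<exists>n. \<alpha> < start ?u n" if "\<alpha> < len ?s" for \<alpha>
  proof -
    have "b 0 + \<alpha> < len w" using that by (metis len plus_cord_less_iff)
    then show ?thesis using assms(3) start by (metis plus_cord_less_iff)
  qed
qed simp

section \<open>Finite presentability\<close>

text \<open>Passing to a subsequence creates new consecutive pairs, so a pigeonhole argument on the
  old ones is not enough; Ramsey's theorem makes all pairs of a subsequence agree.\<close>

lemma finite_range_homogeneous:
  fixes c :: "nat \<Rightarrow> nat \<Rightarrow> 'b"
  assumes "finite C" "\<And>i j. c i j \<in> C"
  obtains g :: "nat \<Rightarrow> nat" where "strict_mono g" "\<And>n. c (g n) (g (Suc n)) = c (g 0) (g (Suc 0))"
proof -
  \<comment> \<open>\<open>Ramsey2\<close> takes colours to be numbers below a bound, so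
    \<open>C\<close> is coded by such numbers.\<close>
  obtain h :: "'b \<Rightarrow> nat" where h: "inj_on h C" "h ` C = {..<card C}"
    using ex_bij_betw_finite_nat[OF assms(1)] by (metis atLeast0LessThan bij_betw_def)
  \<comment> \<open>\<open>Min\<close> and \<open>Max\<close> recover the order of the indices from
    an unordered pair.\<close>
  define f where "f X = h (c (Min X) (Max X))" for X
  have "\<forall>x\<in>UNIV. \<forall>y\<in>UNIV. x \<noteq> y \<longrightarrow> f {x, y} < card C"
    using h assms(2) by (auto simp: f_def)
  from Ramsey2[OF infinite_UNIV_nat this] obtain Y t
    where Y: "infinite Y" "\<forall>x\<in>Y. \<forall>y\<in>Y. x \<noteq> y \<longrightarrow> f {x, y} = t" by blast
  have mono: "strict_mono (enumerate Y)" using strict_mono_enumerate[OF Y(1)] .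
  have "h (c (enumerate Y n) (enumerate Y (Suc n))) = t" for n
  proof -
    have "enumerate Y n < enumerate Y (Suc n)" using mono by (simp add: strict_mono_Suc_iff)
    then show ?thesis
      using Y(2)[rule_format, of "enumerate Y n" "enumerate Y (Suc n)"] enumerate_in_set[OF Y(1)]
      by (simp add: f_def)
  qed
  then have "c (enumerate Y n) (enumerate Y (Suc n)) = c (enumerate Y 0) (enumerate Y (Suc 0))" for n
    using inj_onD[OF h(1)] assms(2) by metis
  with mono that show thesis by blast
qed

lemma equivalent_denote:
  assumes "w \<in> words AP"
  shows "\<exists>A. letters A \<subseteq> Pow AP \<and> equivalent \<phi> w (denote A)"
  using assms
proof (induction "len w" arbitrary: w rule: less_induct)
  case less
  note w = less.prems
  \<comment> \<open>Successor and limit lengths share this reduction: the induction hypothesis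
    handles a nonempty proper prefix, and only the remaining suffix needs an expression.\<close>
  have split: ?case
    if \<beta>: "0 < \<beta>" "\<beta> < len w"
      and B: "letters B \<subseteq> Pow AP" "equivalent \<phi> (suffix w \<beta>) (denote B)" for \<beta> B
  proof -
    have "prefix w \<beta> \<in> words AP" using \<beta> w by (simp add: prefix_in_words)
    then obtain A where A: "letters A \<subseteq> Pow AP" "equivalent \<phi> (prefix w \<beta>) (denote A)"
      using less.hyps[of "prefix w \<beta>"] \<beta> by auto
    have "equivalent \<phi> w (denote (Concat A B))"
      using equivalent_concat[OF A(2) B(2)] concat_prefix_suffix[of w \<beta>] words_wellformed[OF w] \<beta>
      by simp
    with A(1) B(1) show ?thesis by (intro exI[of _ "Concat A B"]) simp
  qed
  \<comment> \<open>Length 1 is separated from the other successors because the prefix before its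
    last letter is empty and hence not in \<open>words\<close>.\<close>
  consider "len w = 1" | \<beta> where "0 < \<beta>" "len w = \<beta> + 1"
    | "1 < len w" "\<And>\<alpha>. \<alpha> < len w \<Longrightarrow> \<alpha> + 1 < len w"
    using words_pos[OF w] one_cord_le_iff plus_one_le_cord cord_pos_iff
    by (metis add_0 le_less)
  then show ?case
  proof cases
    case 1
    have "w = denote (Letter (letter w 0))"
      using words_wellformed[OF w] 1 by (intro word_eqI) (simp_all add: less_one_cord_iff)
    moreover have "letter w 0 \<subseteq> AP" using w by (auto simp: words_def PiE_iff)
    ultimately show ?thesis
      by (intro exI[of _ "Letter (letter w 0)"]) (simp add: equivalent_refl)
  next
    case (2 \<beta>)
    have \<beta>: "\<beta> < len w" by (simp add: 2 less_plus_one_cord)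
    \<comment> \<open>The suffix is a single letter, and it is shorter than \<open>w\<close> because
      \<beta> is positive.\<close>
    moreover have "len (suffix w \<beta>) < len w"
      using 2 one_cord_le_iff[of \<beta>] by (simp add: less_plus_one_cord)
    ultimately show ?thesis using less.hyps[OF _ suffix_in_words[OF w]] split 2(1) by blast
  next
    case 3
    \<comment> \<open>Starting at 1 rather than 0 makes the prefix cut off by \<open>split\<close>
      nonempty.\<close>
    obtain a :: "nat \<Rightarrow> cord" where a: "a 0 = 1" "strict_mono a" "\<And>n. a n < len w"
      "\<And>\<alpha>. \<alpha> < len w \<Longrightarrow> \<exists>n. \<alpha> < a n"
      using cofinal_sequence[OF 3] by metis
    \<comment> \<open>Pairs of cut points are coloured by the action of the factor between them. For
      \<open>i > j\<close> the value is meaningless, but it still lies in the finite range.\<close>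
    define c where "c i j = action \<phi> (prefix (suffix w (a i)) (a j - a i))" for i j
    obtain g :: "nat \<Rightarrow> nat" where g: "strict_mono g"
      "\<And>n. c (g n) (g (Suc n)) = c (g 0) (g (Suc 0))"
      using finite_range_homogeneous[OF finite_range_action, of c \<phi>] by (auto simp: c_def)
    define b where "b n = a (g n)" for n
    define u where "u n = prefix (suffix w (b n)) (b (Suc n) - b n)" for n
    have b_less: "b n < len w" for n by (simp add: b_def a(3))
    have mono: "strict_mono b"
      using a(2) g(1) by (simp add: b_def strict_mono_def)
    have "\<exists>n. \<alpha> < b n" if "\<alpha> < len w" for \<alpha>
    proof -
      from a(4)[OF that] obtain n where "\<alpha> < a n" ..
      also have "a n \<le> b n"
        using a(2) strict_mono_imp_increasing[OF g(1)] by (simp add: b_def strict_mono_less_eq)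
      finally show ?thesis ..
    qed
    from omega_product_suffix[OF mono b_less this] have prod: "omega_product u (suffix w (b 0))"
      by (simp add: u_def[abs_def])
    have u: "equivalent \<phi> (u n) (u 0)" for n
      using g(2)[of n] by (intro action_eq_imp_equivalent) (simp add: u_def b_def c_def)
    have b1: "b 0 + (b (Suc 0) - b 0) = b (Suc 0)"
      using mono by (simp add: cord_plus_minus strict_mono_less_eq)
    have le: "b (Suc 0) - b 0 \<le> len (suffix w (b 0))"
      using omega_product.start_le[OF prod, of "Suc 0"] by (simp add: u_def)
    have "u 0 \<in> words AP"
      using omega_product.pos[OF prod, of 0] le b_less w
      by (simp add: u_def prefix_in_words suffix_in_words)
    \<comment> \<open>The factor ends at \<open>b (Suc 0)\<close>, strictly inside \<open>w\<close>,
      and a right summand never exceeds the sum.\<close>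
    moreover have "len (u 0) < len w"
      using le_plus_cord_right[of "b (Suc 0) - b 0" "b 0"] b_less[of "Suc 0"] by (simp add: u_def b1)
    ultimately obtain B where B: "letters B \<subseteq> Pow AP" "equivalent \<phi> (u 0) (denote B)"
      using less.hyps by blast
    note B_words = denote_in_words[OF B(1)]
    \<comment> \<open>Every factor is equivalent to \<open>u 0\<close>, hence to
      \<open>denote B\<close>, so the suffix is compared with the product of the constant sequence
      \<open>denote B\<close>.\<close>
    have "equivalent \<phi> (suffix w (b 0)) (denote (OmegaPower B))"
      using omega_product_equivalent[OF prod
          omega_product_omega_power[OF words_wellformed[OF B_words] words_pos[OF B_words]]
          equivalent_trans[OF u B(2)]] by simp
    moreover have "0 < b 0"
      using a(1,2) by (metis b_def le0 less_le_trans strict_mono_less_eq zero_less_one_cord)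
    ultimately show ?thesis using split[of "b 0" "OmegaPower B"] b_less B(1) by simp
  qed
qed

theorem theorem8:
  fixes AP :: "'a set" and \<phi> \<psi> :: "'a ltl"
  assumes "finite AP"
    and "atoms \<phi> \<subseteq> AP" and "atoms \<psi> \<subseteq> AP"
    and "language AP \<phi> - language AP \<psi> \<noteq> {}"
  shows "\<exists>w \<in> language AP \<phi> - language AP \<psi>. finitely_presentable AP w"
proof -
  let ?\<chi> = "Conj \<phi> (Neg \<psi>)"
  from assms(4) obtain w where w: "w \<in> words AP" "sat w ?\<chi>"
    by (auto simp: language_def)
  obtain A where A: "letters A \<subseteq> Pow AP" "equivalent ?\<chi> w (denote A)"
    using equivalent_denote[OF w(1)] by blast
  have words: "denote A \<in> words AP" by (rule denote_in_words) fact
  \<comment> \<open>The empty continuation turns equivalence into agreement of the two words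
    themselves.\<close>
  have "sat (denote A) ?\<chi>"
    using equivalent_sat[OF A(2) empty_word(1) subs_self] w words
    by (simp add: concat_word_empty words_wellformed del: sat.simps)
  then show ?thesis
    using words A(1) by (auto simp: language_def finitely_presentable_def intro!: bexI[of _ "denote A"])
qed

end
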